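(* Assume $\gamma_\tau\to1$ as $\tau\to0^+$, and let $\varepsilon$, $\rho$ and $T>0$ be fixed. Let $(\boldsymbol h,\boldsymbol\eta)$ be a solution of $$\boldsymbol h'=\boldsymbol\eta,\qquad \tau\boldsymbol\eta'=\mathcal{P}^*(\boldsymbol h)-\gamma_\tau\boldsymbol\eta,$$ and $(\boldsymbol h_p,\boldsymbol\eta_p)$ a solution of $$\boldsymbol h'=\boldsymbol\eta,\qquad \boldsymbol\eta=\mathcal{P}^*(\boldsymbol h),$$ with $\boldsymbol h(t),\boldsymbol h_p(t)\in\Omega_\rho$ for any $t\in[0,T]$, and set $$\mathrm{E}_\tau(t):=\gamma_\tau|\boldsymbol h(t)-\boldsymbol h_p(t)|+\tau|\boldsymbol\eta(t)-\boldsymbol\eta_p(t)|.$$ Then, for $\tau>0$ small, there exists $C>0$ (independent of $\tau$) such that $$\mathrm{E}_\tau(t)\le C\bigl(\mathrm{E}_\tau(0)+|1-\gamma_\tau|+\tau\bigr)\qquad\text{for } t\in[0,T].$$ Moreover, $$\int_0^T|\boldsymbol\eta(t)-\boldsymbol\eta_p(t)|\,dt\le\frac{C}{\gamma_\tau}\bigl(\mathrm{E}_\tau(0)+|1-\gamma_\tau|+\tau\bigr),$$ and, for all $t_1\in(0,T)$ (with $C$ independent of $\tau$ but possibly depending on $t_1$), $$|\boldsymbol\eta(t)-\boldsymbol\eta_p(t)|\le\frac{C}{\gamma_\tau}\bigl(\mathrm{E}_\tau(0)+|1-\gamma_\tau|+\tau\bigr)\qquad\text{for } t\in[t_1,T].$$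 In particular, if $\gamma_\tau\to1$ and $\mathrm{E}_\tau(0)\to0$ as $\tau\to0$, then $$\lim_{\tau\to0}\sup_{t\in[0,T]}|\boldsymbol h(t)-\boldsymbol h_p(t)|=\lim_{\tau\to0}\int_0^T|\boldsymbol\eta(t)-\boldsymbol\eta_p(t)|\,dt=\lim_{\tau\to0}\sup_{t\in[t_1,T]}|\boldsymbol\eta(t)-\boldsymbol\eta_p(t)|=0$$ for any $t_1\in(0,T)$.
   Context: $|\cdot|$ is the Euclidean norm in $\mathbb{R}^N$, $N\in\mathbb{N}$. $F\in C^3(\mathbb{R})$ satisfies $F(\pm1)=F'(\pm1)=0$, $F''(\pm1)>0$, $F(u)>0$ for $u\ne\pm1$; $f=F'$; for $\tau\in(0,\tau_0)$ ($\tau_0\in(0,+\infty]$), $g(\cdot,\tau)\in C^1(\mathbb{R})$ satisfies $g(u,\tau)\ge c_g>0$ for all $u$ ($c_g$ possibly depending on $\tau$). The solution $(\boldsymbol h,\boldsymbol\eta)$ depends on $\tau$; $T$ does not. For $\rho>0$ and $\varepsilon>0$, $$\Omega_\rho:=\{\boldsymbol h=(h_1,\dots,h_N)\in\mathbb{R}^N:\ 0<h_1<\dots<h_N<1,\ h_j-h_{j-1}>\varepsilon/\rho\ \text{ for } j=1,\dots,N+1\},$$ with $h_0:=-h_1$, $h_{N+1}:=2-h_N$. There is $L_0>0$ such that for $\ell>\varepsilon L_0$ one has functions $\phi(\cdot,\ell,\pm1)$ solving $-\varepsilon^2\phi_{xx}+f(\phi)=0$ with $\phi(-\ell/2)=\phi(\ell/2)=0$,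 with $\phi(\cdot,\ell,+1)>0$ and $\phi(\cdot,\ell,-1)<0$ in $(-\ell/2,\ell/2)$; $\max|\phi(\cdot,\ell,\pm1)|=|\phi(0,\ell,\pm1)|$ is in $(0,1)$ and tends to $1$ as $\varepsilon/\ell\to0$. The parameter $\rho$ is assumed sufficiently small, in particular $\rho<1/L_0$. The value $\phi(0,\ell,\pm1)$ depends only on $r=\varepsilon/\ell$; set $\alpha_\pm(r):=F(\phi(0,\ell,\pm1))$. For $j=0,\dots,N$, with $r_{j+1/2}:=\varepsilon/(h_{j+1}-h_j)$, set $\alpha^{j+1/2}:=\alpha_+(r_{j+1/2})$ if $j$ is odd and $\alpha^{j+1/2}:=\alpha_-(r_{j+1/2})$ if $j$ is even. Set $$D_\infty:=\int_{-1}^1\sqrt{2F(s)}\,ds,\qquad \gamma_\tau:=\frac{\sqrt2}{D_\infty}\int_{-1}^1\sqrt{F(s)}\,g(s,\tau)\,ds,$$ $$\mathcal{P}^*_j(\boldsymbol h):=\varepsilon D_\infty^{-1}\bigl(\alpha^{j+1/2}-\alpha^{j-1/2}\bigr),\qquad j=1,\dots,N.$$ *)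

theory Defs
  imports "HOL-Analysis.Analysis"
begin

definition C_k :: "nat \<Rightarrow> (real \<Rightarrow> real) \<Rightarrow> bool" where
  "C_k n f \<longleftrightarrow>
     (\<forall>k<n. \<forall>x. (deriv ^^ k) f field_differentiable at x) \<and> continuous_on UNIV ((deriv ^^ n) f)"

definition double_well :: "(real \<Rightarrow> real) \<Rightarrow> bool" where
  "double_well F \<longleftrightarrow>
     C_k 3 F \<and> F 1 = 0 \<and> F (-1) = 0 \<and> deriv F 1 = 0 \<and> deriv F (-1) = 0 \<and>
     deriv (deriv F) 1 > 0 \<and> deriv (deriv F) (-1) > 0 \<and>
     (\<forall>u. u \<noteq> 1 \<longrightarrow> u \<noteq> -1 \<longrightarrow> F u > 0)"

definition damping :: "ereal \<Rightarrow> (real \<Rightarrow> real \<Rightarrow> real) \<Rightarrow> bool" where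
  "damping \<tau>0 g \<longleftrightarrow>
     (\<forall>\<tau>>0. ereal \<tau> < \<tau>0 \<longrightarrow> C_k 1 (\<lambda>u. g u \<tau>) \<and> (\<exists>c>0. \<forall>u. g u \<tau> \<ge> c))"

text \<open>
  \<open>steady_profile F \<epsilon> l \<sigma> \<phi>\<close>: on the closed interval from \<open>-l/2\<close> to \<open>l/2\<close>
  (one-sided derivatives at the end points), \<open>\<phi>\<close> solves
  \<open>-\<epsilon>\<^sup>2 \<phi>'' + F' \<circ> \<phi> = 0\<close> with zero boundary values, has the sign \<open>\<sigma> = \<plusminus>1\<close> inside, and
  \<open>\<bar>\<phi>\<bar>\<close> attains its maximum, a number strictly between 0 and 1, at the origin.
\<close>

definition steady_profile ::
    "(real \<Rightarrow> real) \<Rightarrow> real \<Rightarrow> real \<Rightarrow> real \<Rightarrow> (real \<Rightarrow> real) \<Rightarrow> bool" where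
  "steady_profile F \<epsilon> l \<sigma> \<phi> \<longleftrightarrow>
     (\<exists>\<phi>x \<phi>xx. \<forall>x\<in>{-l/2..l/2}.
        (\<phi> has_real_derivative \<phi>x x) (at x within {-l/2..l/2}) \<and>
        (\<phi>x has_real_derivative \<phi>xx x) (at x within {-l/2..l/2}) \<and>
        - \<epsilon>\<^sup>2 * \<phi>xx x + deriv F (\<phi> x) = 0) \<and>
     \<phi> (-l/2) = 0 \<and> \<phi> (l/2) = 0 \<and>
     (\<forall>x\<in>{-l/2<..<l/2}. \<sigma> * \<phi> x > 0) \<and>
     (\<forall>x\<in>{-l/2..l/2}. \<bar>\<phi> x\<bar> \<le> \<bar>\<phi> 0\<bar>) \<and> 0 < \<bar>\<phi> 0\<bar> \<and> \<bar>\<phi> 0\<bar> < 1"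

text \<open>
  The profiles depend on \<open>\<epsilon>\<close>, which is written here as an explicit argument:
  \<open>\<phi> \<epsilon> x l \<sigma>\<close> with \<open>\<sigma> \<in> {1, -1}\<close>, meaningful for \<open>l > \<epsilon> L0\<close>.
\<close>

definition profile_family ::
    "(real \<Rightarrow> real) \<Rightarrow> real \<Rightarrow> (real \<Rightarrow> real \<Rightarrow> real \<Rightarrow> real \<Rightarrow> real) \<Rightarrow> bool" where
  "profile_family F L0 \<phi> \<longleftrightarrow>
     L0 > 0 \<and>
     (\<forall>\<sigma>\<in>{1, -1}.
        (\<forall>\<epsilon>>0. \<forall>l>\<epsilon> * L0. steady_profile F \<epsilon> l \<sigma> (\<lambda>x. \<phi> \<epsilon> x l \<sigma>)) \<and>
        (\<forall>\<epsilon>>0. \<forall>\<epsilon>'>0. \<forall>l>\<epsilon> * L0. \<forall>l'>\<epsilon>' * L0.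
           \<epsilon> / l = \<epsilon>' / l' \<longrightarrow> \<phi> \<epsilon> 0 l \<sigma> = \<phi> \<epsilon>' 0 l' \<sigma>) \<and>
        (\<forall>\<epsilon>>0. ((\<lambda>r. \<bar>\<phi> \<epsilon> 0 (\<epsilon> / r) \<sigma>\<bar>) \<longlongrightarrow> 1) (at_right 0)))"

text \<open>\<open>alpha F \<phi> \<epsilon> \<sigma> r\<close> is \<open>F (\<phi>(0, l, \<sigma>))\<close> for the \<open>l\<close> with \<open>r = \<epsilon> / l\<close>.\<close>

definition alpha ::
    "(real \<Rightarrow> real) \<Rightarrow> (real \<Rightarrow> real \<Rightarrow> real \<Rightarrow> real \<Rightarrow> real) \<Rightarrow> real \<Rightarrow> real \<Rightarrow> real \<Rightarrow> real" where
  "alpha F \<phi> \<epsilon> \<sigma> r = F (\<phi> \<epsilon> 0 (\<epsilon> / r) \<sigma>)"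

text \<open>
  A vector of \<open>\<real>\<^sup>N\<close> is a function on \<open>nat\<close> of which only the values at \<open>1, \<dots>, N\<close> matter; its
  Euclidean norm is \<open>L2_set _ {1..N}\<close>. \<open>ext N h\<close> adds the two reflected points at
  the indices \<open>0\<close> and \<open>N + 1\<close>.
\<close>

definition ext :: "nat \<Rightarrow> (nat \<Rightarrow> real) \<Rightarrow> nat \<Rightarrow> real" where
  "ext N h j = (if j = 0 then - h 1 else if j = N + 1 then 2 - h N else h j)"

definition Omega :: "nat \<Rightarrow> real \<Rightarrow> real \<Rightarrow> (nat \<Rightarrow> real) set" where
  "Omega N \<epsilon> \<rho> =
     {h. 0 < h 1 \<and> (\<forall>j\<in>{1..<N}. h j < h (j + 1)) \<and> h N < 1 \<and>
         (\<forall>j\<in>{1..N + 1}. ext N h j - ext N h (j - 1) > \<epsilon> / \<rho>)}"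

text \<open>\<open>alpha_half F \<phi> \<epsilon> N h j\<close> is the quantity with superscript \<open>j + 1/2\<close>, for \<open>j = 0, \<dots>, N\<close>.\<close>

definition alpha_half ::
    "(real \<Rightarrow> real) \<Rightarrow> (real \<Rightarrow> real \<Rightarrow> real \<Rightarrow> real \<Rightarrow> real) \<Rightarrow> real \<Rightarrow> nat \<Rightarrow> (nat \<Rightarrow> real) \<Rightarrow> nat \<Rightarrow> real"
  where
  "alpha_half F \<phi> \<epsilon> N h j =
     alpha F \<phi> \<epsilon> (if odd j then 1 else -1) (\<epsilon> / (ext N h (j + 1) - ext N h j))"

definition D_inf :: "(real \<Rightarrow> real) \<Rightarrow> real" where
  "D_inf F = integral {-1..1} (\<lambda>s. sqrt (2 * F s))"

definition gam :: "(real \<Rightarrow> real) \<Rightarrow> (real \<Rightarrow> real \<Rightarrow> real) \<Rightarrow> real \<Rightarrow> real" where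
  "gam F g \<tau> = sqrt 2 / D_inf F * integral {-1..1} (\<lambda>s. sqrt (F s) * g s \<tau>)"

definition P_star ::
    "(real \<Rightarrow> real) \<Rightarrow> (real \<Rightarrow> real \<Rightarrow> real \<Rightarrow> real \<Rightarrow> real) \<Rightarrow> real \<Rightarrow> nat \<Rightarrow> (nat \<Rightarrow> real) \<Rightarrow> nat \<Rightarrow> real"
  where
  "P_star F \<phi> \<epsilon> N h j = \<epsilon> / D_inf F * (alpha_half F \<phi> \<epsilon> N h j - alpha_half F \<phi> \<epsilon> N h (j - 1))"

text \<open>Trajectories are written \<open>h t j\<close>, with time \<open>t\<close> in \<open>[0, T]\<close> and component \<open>j\<close>.\<close>

definition hyperbolic_solution ::
    "nat \<Rightarrow> real \<Rightarrow> ((nat \<Rightarrow> real) \<Rightarrow> nat \<Rightarrow> real) \<Rightarrow> real \<Rightarrow> real \<Rightarrow>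
     (real \<Rightarrow> nat \<Rightarrow> real) \<Rightarrow> (real \<Rightarrow> nat \<Rightarrow> real) \<Rightarrow> bool" where
  "hyperbolic_solution N T P \<tau> \<gamma> h \<eta> \<longleftrightarrow>
     (\<forall>t\<in>{0..T}. \<forall>j\<in>{1..N}.
        ((\<lambda>s. h s j) has_real_derivative \<eta> t j) (at t within {0..T}) \<and>
        (\<exists>\<eta>'. ((\<lambda>s. \<eta> s j) has_real_derivative \<eta>') (at t within {0..T}) \<and>
              \<tau> * \<eta>' = P (h t) j - \<gamma> * \<eta> t j))"

definition parabolic_solution ::
    "nat \<Rightarrow> real \<Rightarrow> ((nat \<Rightarrow> real) \<Rightarrow> nat \<Rightarrow> real) \<Rightarrow>
     (real \<Rightarrow> nat \<Rightarrow> real) \<Rightarrow> (real \<Rightarrow> nat \<Rightarrow> real) \<Rightarrow> bool" where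
  "parabolic_solution N T P h \<eta> \<longleftrightarrow>
     (\<forall>t\<in>{0..T}. \<forall>j\<in>{1..N}.
        ((\<lambda>s. h s j) has_real_derivative \<eta> t j) (at t within {0..T}) \<and> \<eta> t j = P (h t) j)"

definition vdist :: "nat \<Rightarrow> (nat \<Rightarrow> real) \<Rightarrow> (nat \<Rightarrow> real) \<Rightarrow> real" where
  "vdist N x y = L2_set (\<lambda>j. x j - y j) {1..N}"

end

theory Submission
  imports Defs
begin

text \<open>
  The two systems are compared through the quantity
  \<open>z = \<gamma> (h - h\<^sub>p) + \<tau> \<eta>\<close>. Its derivative is \<open>P h - P h\<^sub>p + (1 - \<gamma>) \<eta>\<^sub>p\<close>: the stiff factor
  \<open>1 / \<tau>\<close> has cancelled. If \<open>P\<close> is Lipschitz on \<open>\<Omega>\<^sub>\<rho>\<close>, then \<open>z - \<tau> \<eta>\<^sub>p\<close> is therefore controlled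
  by its initial value, by \<open>\<bar>1 - \<gamma>\<bar>\<close>, by \<open>\<tau>\<close> and by the history of \<open>h - h\<^sub>p\<close>. In turn \<open>u = h - h\<^sub>p\<close> solves
  \<open>\<tau> u' = (z - \<tau> \<eta>\<^sub>p) - \<gamma> u\<close>, a linear relaxation towards \<open>(z - \<tau> \<eta>\<^sub>p) / \<gamma>\<close>, so that the
  history of \<open>z - \<tau> \<eta>\<^sub>p\<close> controls \<open>u\<close>. The loop is closed as in Gronwall's lemma, and this bounds
  \<open>E\<close> (\<open>hyperbolic_parabolic_estimate\<close>). The velocity equation
  \<open>\<tau> \<eta>' = P h - \<gamma> \<eta>\<close> is also a relaxation; its target stays close to \<open>\<eta>\<^sub>p\<close>, which is
  Lipschitz in time. Hence \<open>\<eta> - \<eta>\<^sub>p\<close> is the sum of a small term and of an initial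
  layer \<open>e\<^bsup>-\<gamma>t/\<tau>\<^esup>\<close> times the initial error. The layer may have height \<open>1 / \<tau>\<close> times \<open>E\<close> at time
  zero, but its integral carries a factor \<open>\<tau>\<close>, and so does its value away from time zero. This
  gives the bounds on \<open>\<eta> - \<eta>\<^sub>p\<close>, and the limits follow from the bounds.

  What remains is that \<open>P\<^sup>*\<close> is Lipschitz on \<open>\<Omega>\<^sub>\<rho>\<close> for small \<open>\<rho>\<close>
  (\<open>P_star_lipschitz\<close>), that is, that the energy \<open>F M\<close> of the peak value \<open>M\<close> of a profile is a
  Lipschitz function of the length of its interval (\<open>peak_energy_lipschitz\<close>). Let two profiles have peaks
  \<open>M\<^sub>1 < M\<^sub>2\<close> close to \<open>1\<close>. While both stay above a level
  \<open>1 - \<delta>\<close> where \<open>F'\<close> is increasing, their distance cannot shrink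
  (\<open>profiles_separate\<close>), and the speed is bounded, so the second one reaches that level later, by
  at least a multiple of \<open>M\<^sub>2 - M\<^sub>1\<close>. Below the level the time to descend is an integral
  (\<open>transit_time\<close>) that is a Lipschitz function of the peak energy, and
  \<open>F M\<^sub>1 - F M\<^sub>2\<close> is a small multiple of \<open>M\<^sub>2 - M\<^sub>1\<close> because \<open>F' 1 = 0\<close>. So the second
  profile is longer by at least a multiple of \<open>M\<^sub>2 - M\<^sub>1\<close>.
\<close>

section \<open>Calculus on closed intervals\<close>

lemma within_mono:
  fixes p :: "real \<Rightarrow> real"
  assumes "a \<le> b"
    and der: "\<And>x. x \<in> {a..b} \<Longrightarrow> (p has_real_derivative p' x) (at x within {a..b})"
    and nn: "\<And>x. x \<in> {a..b} \<Longrightarrow> 0 \<le> p' x"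
  shows "p a \<le> p b"
proof -
  have "\<exists>x\<in>{a..b}. p b - p a = (*) (p' x) (b - a)"
    using der by (intro mvt_very_simple) (auto simp: has_field_derivative_def assms(1))
  then obtain x where "x \<in> {a..b}" "p b - p a = p' x * (b - a)"
    by blast
  moreover from this(1) have "0 \<le> p' x * (b - a)"
    using nn assms(1) by simp
  ultimately show ?thesis
    by linarith
qed

text \<open>
  A comparison form of the mean value theorem: the majorant \<open>k\<close> is given by its derivative, so
  that time-dependent bounds can be integrated without integrals.
\<close>

lemma growth_bound:
  fixes p k :: "real \<Rightarrow> real"
  assumes "a \<le> b"
    and p: "\<And>x. x \<in> {a..b} \<Longrightarrow> (p has_real_derivative p' x) (at x within {a..b})"
    and k: "\<And>x. x \<in> {a..b} \<Longrightarrow> (k has_real_derivative k' x) (at x within {a..b})"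
    and le: "\<And>x. x \<in> {a..b} \<Longrightarrow> \<bar>p' x\<bar> \<le> k' x"
  shows "\<bar>p b - p a\<bar> \<le> k b - k a"
proof -
  have "k a - p a \<le> k b - p b"
    using le by (intro within_mono[OF \<open>a \<le> b\<close> DERIV_diff[OF k p]]) (auto simp: abs_le_iff)
  moreover have "k a + p a \<le> k b + p b"
    using le by (intro within_mono[OF \<open>a \<le> b\<close> DERIV_add[OF k p]]) (force simp: abs_le_iff)+
  ultimately show ?thesis
    by linarith
qed

lemma first_hit:
  fixes p :: "real \<Rightarrow> real"
  assumes "a \<le> b" "continuous_on {a..b} p" "p a > c" "p b \<le> c"
  obtains y where "a < y" "y \<le> b" "p y = c" "\<And>x. a \<le> x \<Longrightarrow> x < y \<Longrightarrow> p x > c"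
proof -
  define S where "S = {x \<in> {a..b}. p x \<le> c}"
  have "closed S"
    unfolding S_def using assms(2)
    by (intro continuous_on_closed_Collect_le) auto
  have S: "b \<in> S" "bdd_below S"
    using assms by (auto simp: S_def)
  define y where "y = Inf S"
  have "y \<in> S"
    unfolding y_def using S \<open>closed S\<close> by (intro closed_contains_Inf) auto
  have less: "p x > c" if "a \<le> x" "x < y" for x
  proof (rule ccontr)
    assume "\<not> p x > c"
    then have "x \<in> S" using that \<open>y \<in> S\<close> by (auto simp: S_def)
    then have "y \<le> x" unfolding y_def using S(2) by (rule cInf_lower)
    then show False using that by simp
  qed
  have "a \<le> y" "y \<le> b" "p y \<le> c" using \<open>y \<in> S\<close> by (auto simp: S_def)
  then have "\<exists>x\<ge>a. x \<le> y \<and> p x = c"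
    using assms by (intro IVT2') (auto intro: continuous_on_subset)
  then obtain x where "a \<le> x" "x \<le> y" "p x = c" by blast
  then have "p y = c" using less[of x] by fastforce
  moreover have "a < y" using \<open>a \<le> y\<close> \<open>p y \<le> c\<close> assms(3) by (cases "a = y") auto
  ultimately show ?thesis using that \<open>y \<le> b\<close> less by blast
qed

lemma inverse_sqrt_diff_le:
  fixes p q m :: real
  assumes "0 < m" "m \<le> p" "p \<le> q"
  shows "1 / sqrt p - 1 / sqrt q \<le> (q - p) / (m * sqrt m)"
proof -
  have s: "0 < sqrt m" "sqrt m \<le> sqrt p" "sqrt p \<le> sqrt q" using assms by auto
  have "1 / sqrt p - 1 / sqrt q = (sqrt q - sqrt p) / (sqrt p * sqrt q)"
    using s by (simp add: field_simps)
  also have "\<dots> = (q - p) / ((sqrt p + sqrt q) * (sqrt p * sqrt q))"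
  proof -
    have "q - p = (sqrt p + sqrt q) * (sqrt q - sqrt p)"
      using assms by (simp add: algebra_simps flip: power2_eq_square)
    moreover have "sqrt p + sqrt q \<noteq> 0" using s by linarith
    ultimately show ?thesis by simp
  qed
  also have "\<dots> \<le> (q - p) / (m * sqrt m)"
  proof (rule divide_left_mono)
    have "sqrt m * (sqrt m * sqrt m) \<le> (sqrt p + sqrt q) * (sqrt p * sqrt q)"
      using s by (intro mult_mono mult_nonneg_nonneg) linarith+
    then show "m * sqrt m \<le> (sqrt p + sqrt q) * (sqrt p * sqrt q)"
      using assms by (simp add: mult.commute)
    show "0 < (sqrt p + sqrt q) * (sqrt p * sqrt q) * (m * sqrt m)"
      using s assms(1) by (intro mult_pos_pos) linarith+
  qed (use assms in auto)
  finally show ?thesis .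
qed

section \<open>How the peak of a profile depends on its length\<close>

text \<open>
  Both wells of the potential are treated at once, as the right-hand well \<open>1\<close> of
  \<open>F\<close> or of its reflection \<open>u \<mapsto> F (- u)\<close>.
\<close>

definition right_well :: "(real \<Rightarrow> real) \<Rightarrow> (real \<Rightarrow> real) \<Rightarrow> (real \<Rightarrow> real) \<Rightarrow> bool" where
  "right_well F f f' \<longleftrightarrow> (\<forall>u. (F has_real_derivative f u) (at u)) \<and>
     (\<forall>u. (f has_real_derivative f' u) (at u)) \<and> isCont f' 1 \<and>
     F 1 = 0 \<and> f 1 = 0 \<and> f' 1 > 0 \<and> (\<forall>u. 0 \<le> u \<longrightarrow> u < 1 \<longrightarrow> F u > 0)"

lemma right_wellD:
  assumes "right_well F f f'"
  shows "(F has_real_derivative f u) (at u)" "(f has_real_derivative f' u) (at u)" "isCont f' 1"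
    "F 1 = 0" "f 1 = 0" "f' 1 > 0" "0 \<le> u \<Longrightarrow> u < 1 \<Longrightarrow> F u > 0" "continuous_on S F"
proof -
  show F_deriv: "(F has_real_derivative f u) (at u)" for u
    using assms by (simp add: right_well_def)
  show "(f has_real_derivative f' u) (at u)" "isCont f' 1" "F 1 = 0" "f 1 = 0" "f' 1 > 0"
    "0 \<le> u \<Longrightarrow> u < 1 \<Longrightarrow> F u > 0"
    using assms by (simp_all add: right_well_def)
  show "continuous_on S F"
    using F_deriv by (meson DERIV_isCont continuous_at_imp_continuous_on)
qed

text \<open>
  The right half of a positive profile on an interval of length \<open>2 b\<close>, for \<open>\<epsilon> = 1\<close>: \<open>v\<close> is its
  derivative and \<open>M\<close> its peak value, attained at \<open>0\<close>.
\<close>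

definition half_profile :: "(real \<Rightarrow> real) \<Rightarrow> real \<Rightarrow> real \<Rightarrow> (real \<Rightarrow> real) \<Rightarrow> (real \<Rightarrow> real) \<Rightarrow> bool" where
  "half_profile f b M \<psi> v \<longleftrightarrow> 0 \<le> b \<and> \<psi> 0 = M \<and> v 0 = 0 \<and> \<psi> b = 0 \<and>
     (\<forall>x\<in>{0..b}. (\<psi> has_real_derivative v x) (at x within {0..b}) \<and>
        (v has_real_derivative f (\<psi> x)) (at x within {0..b}) \<and> 0 \<le> \<psi> x \<and> \<psi> x \<le> M)"

lemma half_profile_derivs:
  assumes "half_profile f b M \<psi> v" "0 \<le> c" "d \<le> b" "x \<in> {c..d}"
  shows "(\<psi> has_real_derivative v x) (at x within {c..d})"
    and "(v has_real_derivative f (\<psi> x)) (at x within {c..d})"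
proof -
  have "{c..d} \<subseteq> {0..b}" "x \<in> {0..b}" using assms by auto
  then show "(\<psi> has_real_derivative v x) (at x within {c..d})"
    "(v has_real_derivative f (\<psi> x)) (at x within {c..d})"
    using assms(1) unfolding half_profile_def by (blast intro: DERIV_subset)+
qed

lemma half_profile_range: "half_profile f b M \<psi> v \<Longrightarrow> x \<in> {0..b} \<Longrightarrow> 0 \<le> \<psi> x \<and> \<psi> x \<le> M"
  unfolding half_profile_def by blast

text \<open>
  Conservation of energy along the orbit, which starts at rest from \<open>M\<close>.
\<close>

lemma half_profile_energy:
  assumes well: "right_well F f f'" and hp: "half_profile f b M \<psi> v" and x: "x \<in> {0..b}"
  shows "(v x)\<^sup>2 = 2 * (F (\<psi> x) - F M)"
proof -
  let ?G = "\<lambda>x. (v x)\<^sup>2 - 2 * F (\<psi> x)"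
  have der: "(?G has_real_derivative 0) (at y within {0..b})" if "y \<in> {0..b}" for y
  proof -
    have "(\<psi> has_real_derivative v y) (at y within {0..b})"
      "(v has_real_derivative f (\<psi> y)) (at y within {0..b})"
      using hp that by (auto simp: half_profile_def)
    moreover from this(1) have "((\<lambda>x. F (\<psi> x)) has_real_derivative f (\<psi> y) * v y) (at y within {0..b})"
      using DERIV_chain2[OF right_wellD(1)[OF well]] by blast
    ultimately show ?thesis
      by (auto intro!: derivative_eq_intros)
  qed
  have "?G x = ?G 0"
    using has_field_derivative_zero_constant[of "{0..b}" ?G] der x by (auto simp del: power2_eq_iff)
  then show ?thesis
    using hp x by (auto simp: half_profile_def)
qed

text \<open>
  Above \<open>1 - \<delta>\<close> the equation makes \<open>\<psi>\<close> concave, so \<open>v\<close> is nonpositive up to the first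
  time \<open>x\<^sub>1\<close> at which \<open>\<psi>\<close> equals \<open>1 - \<delta>\<close>. From then on
  concavity may fail, because \<open>f\<close> may change sign between \<open>0\<close> and \<open>1 - \<delta>\<close>, but the energy
  forbids zeros of \<open>v\<close>.
\<close>

lemma half_profile_descent:
  assumes well: "right_well F f f'" and hp: "half_profile f b M \<psi> v"
    and \<delta>: "0 < \<delta>" "\<delta> < 1" "1 - \<delta> < M" "M < 1"
    and f_le: "\<And>u. 1 - \<delta> \<le> u \<Longrightarrow> u \<le> 1 \<Longrightarrow> f u \<le> 0"
    and m: "\<And>u. 0 \<le> u \<Longrightarrow> u \<le> 1 - \<delta> \<Longrightarrow> F M < F u"
  obtains x\<^sub>1 where "0 < x\<^sub>1" "x\<^sub>1 \<le> b" "\<psi> x\<^sub>1 = 1 - \<delta>"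
    "\<And>x. x \<in> {0..x\<^sub>1} \<Longrightarrow> 1 - \<delta> \<le> \<psi> x"
    "\<And>x. x \<in> {x\<^sub>1..b} \<Longrightarrow> \<psi> x \<le> 1 - \<delta> \<and> v x < 0"
proof -
  note H = hp[unfolded half_profile_def]
  note deriv = half_profile_derivs[OF hp]
  have "v 0 = 0" using H by blast
  have cont: "continuous_on {0..b} \<psi>" "continuous_on {0..b} v"
    by (rule DERIV_continuous_on[OF deriv(1)] DERIV_continuous_on[OF deriv(2)]; simp)+
  obtain x\<^sub>1 where x1: "0 < x\<^sub>1" "x\<^sub>1 \<le> b" "\<psi> x\<^sub>1 = 1 - \<delta>"
      "\<And>x. 0 \<le> x \<Longrightarrow> x < x\<^sub>1 \<Longrightarrow> \<psi> x > 1 - \<delta>"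
    using first_hit[of 0 b \<psi> "1 - \<delta>"] H cont \<delta> by auto
  have above: "1 - \<delta> \<le> \<psi> x" if "x \<in> {0..x\<^sub>1}" for x
    using x1 that by (cases "x = x\<^sub>1") (auto simp: less_imp_le)
  have "- v 0 \<le> - v x\<^sub>1"
  proof (rule within_mono[where p = "\<lambda>x. - v x" and p' = "\<lambda>x. - f (\<psi> x)"])
    fix x assume x: "x \<in> {0..x\<^sub>1}"
    show "((\<lambda>x. - v x) has_real_derivative - f (\<psi> x)) (at x within {0..x\<^sub>1})"
      using x x1 by (intro DERIV_minus deriv) auto
    show "0 \<le> - f (\<psi> x)"
      using f_le[OF above[OF x]] half_profile_range[OF hp, of x] x x1(2) \<delta>(4) by auto
  qed (use x1 in auto)
  moreover have nz: "v x \<noteq> 0" if "x \<in> {0..b}" "\<psi> x \<le> 1 - \<delta>" for x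
    using half_profile_energy[OF well hp that(1)] m[of "\<psi> x"] that H by force
  ultimately have vx1: "v x\<^sub>1 < 0"
    using nz[of x\<^sub>1] x1(1-3) \<open>v 0 = 0\<close> by (simp add: less_le)
  have below: "\<psi> x \<le> 1 - \<delta>" if "x \<in> {x\<^sub>1..b}" "\<And>y. y \<in> {x\<^sub>1..<x} \<Longrightarrow> v y < 0" "v x \<le> 0" for x
  proof -
    have "- \<psi> x\<^sub>1 \<le> - \<psi> x"
    proof (rule within_mono[where p = "\<lambda>x. - \<psi> x" and p' = "\<lambda>x. - v x"])
      fix y assume y: "y \<in> {x\<^sub>1..x}"
      show "((\<lambda>x. - \<psi> x) has_real_derivative - v y) (at y within {x\<^sub>1..x})"
        using y x1 that by (intro DERIV_minus deriv) auto
      show "0 \<le> - v y"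
        using that y by (cases "y = x") (auto simp: less_imp_le)
    qed (use that in auto)
    then show ?thesis using x1 by simp
  qed
  have neg: "v x < 0" if x: "x \<in> {x\<^sub>1..b}" for x
  proof (rule ccontr)
    assume "\<not> v x < 0"
    moreover have "continuous_on {x\<^sub>1..x} (\<lambda>x. - v x)"
      using x x1 by (intro continuous_on_minus continuous_on_subset[OF cont(2)]) auto
    ultimately obtain y where y: "x\<^sub>1 < y" "y \<le> x" "- v y = 0" "\<And>z. x\<^sub>1 \<le> z \<Longrightarrow> z < y \<Longrightarrow> - v z > 0"
      using first_hit[of x\<^sub>1 x "\<lambda>x. - v x" 0] x vx1 by auto
    then have "\<psi> y \<le> 1 - \<delta>"
      using x by (intro below) auto
    then show False
      using nz[of y] y x x1 by auto
  qed
  show ?thesis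
    using that[OF x1(1-3) above] neg below by (simp add: less_imp_le)
qed

text \<open>
  With \<open>w = \<psi>\<^sub>2 - \<psi>\<^sub>1\<close>, monotonicity of \<open>f\<close> gives \<open>w w'' \<ge> 0\<close> whatever the sign of \<open>w\<close>.
  Hence \<open>w w'\<close> increases from \<open>0\<close>, hence \<open>w\<^sup>2\<close> increases, and \<open>w\<close> cannot change sign.
\<close>

lemma profiles_separate:
  assumes hp: "half_profile f b\<^sub>1 M\<^sub>1 \<psi>\<^sub>1 v\<^sub>1" "half_profile f b\<^sub>2 M\<^sub>2 \<psi>\<^sub>2 v\<^sub>2" "M\<^sub>1 < M\<^sub>2" "M\<^sub>2 < 1"
    and y: "0 \<le> y" "y \<le> b\<^sub>1" "y \<le> b\<^sub>2"
    and mono: "mono_on {c..1} f"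
    and above: "\<And>x. x \<in> {0..y} \<Longrightarrow> c \<le> \<psi>\<^sub>1 x \<and> c \<le> \<psi>\<^sub>2 x"
  shows "M\<^sub>2 - M\<^sub>1 \<le> \<psi>\<^sub>2 y - \<psi>\<^sub>1 y"
proof -
  define w where "w x = \<psi>\<^sub>2 x - \<psi>\<^sub>1 x" for x
  define w' where "w' x = v\<^sub>2 x - v\<^sub>1 x" for x
  note H = hp(1,2)[unfolded half_profile_def]
  have w: "(w has_real_derivative w' x) (at x within {0..z})"
    and w': "(w' has_real_derivative f (\<psi>\<^sub>2 x) - f (\<psi>\<^sub>1 x)) (at x within {0..z})"
    if "x \<in> {0..z}" "z \<le> y" for x z
    unfolding w_def[abs_def] w'_def[abs_def] using y that
    by (intro DERIV_diff half_profile_derivs[OF hp(1)] half_profile_derivs[OF hp(2)]; simp)+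
  have f_mono: "0 \<le> w x * (f (\<psi>\<^sub>2 x) - f (\<psi>\<^sub>1 x))" if "x \<in> {0..y}" for x
  proof -
    have "c \<le> \<psi>\<^sub>1 x" "c \<le> \<psi>\<^sub>2 x" "\<psi>\<^sub>1 x \<le> 1" "\<psi>\<^sub>2 x \<le> 1"
      using above[OF that] half_profile_range[OF hp(1), of x] half_profile_range[OF hp(2), of x]
        that y hp(3,4) by auto
    then show ?thesis
      unfolding w_def using mono_onD[OF mono, of "\<psi>\<^sub>1 x" "\<psi>\<^sub>2 x"] mono_onD[OF mono, of "\<psi>\<^sub>2 x" "\<psi>\<^sub>1 x"]
      by (cases "\<psi>\<^sub>1 x \<le> \<psi>\<^sub>2 x") (auto intro: mult_nonneg_nonneg mult_nonpos_nonpos)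
  qed
  have ww': "0 \<le> w z * w' z" if "z \<in> {0..y}" for z
  proof -
    have "w 0 * w' 0 \<le> w z * w' z"
    proof (rule within_mono[where p = "\<lambda>x. w x * w' x" and p' = "\<lambda>x. w' x * w' x + (f (\<psi>\<^sub>2 x) - f (\<psi>\<^sub>1 x)) * w x"])
      fix x assume x: "x \<in> {0..z}"
      show "((\<lambda>x. w x * w' x) has_real_derivative w' x * w' x + (f (\<psi>\<^sub>2 x) - f (\<psi>\<^sub>1 x)) * w x)
          (at x within {0..z})"
        using x that by (intro DERIV_mult w w') auto
      show "0 \<le> w' x * w' x + (f (\<psi>\<^sub>2 x) - f (\<psi>\<^sub>1 x)) * w x"
        using f_mono[of x] x that by (simp add: mult.commute)
    qed (use that in auto)
    then show ?thesis using H by (simp add: w'_def)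
  qed
  have sq: "(w 0)\<^sup>2 \<le> (w z)\<^sup>2" if "z \<in> {0..y}" for z
  proof (rule within_mono[where p = "\<lambda>x. (w x)\<^sup>2" and p' = "\<lambda>x. 2 * (w x * w' x)"])
    fix x assume x: "x \<in> {0..z}"
    show "((\<lambda>x. (w x)\<^sup>2) has_real_derivative 2 * (w x * w' x)) (at x within {0..z})"
      using x that by (auto intro!: derivative_eq_intros w)
    show "0 \<le> 2 * (w x * w' x)"
      using ww'[of x] x that by auto
  qed (use that in auto)
  have w0: "w 0 = M\<^sub>2 - M\<^sub>1" using H by (simp add: w_def)
  have "w y > 0"
  proof (rule ccontr)
    assume "\<not> w y > 0"
    moreover have "continuous_on {0..y} w"
      by (rule DERIV_continuous_on[OF w]) auto
    ultimately obtain z where "0 \<le> z" "z \<le> y" "w z = 0"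
      using IVT2'[of w y 0 0] w0 hp(3) y by auto
    then show False using sq[of z] w0 hp(3) by simp
  qed
  then have "w 0 \<le> w y"
    using power2_le_imp_le[OF sq[of y]] y by simp
  then show ?thesis using w0 by (simp add: w_def)
qed

text \<open>
  Along the descent energy conservation reads \<open>dx = - du / sqrt (2 (F u - F M))\<close>; the integrand
  is regular because the interval ends at a level \<open>c\<close> of energy above \<open>F M\<close>.
\<close>

lemma transit_time:
  assumes well: "right_well F f f'" and hp: "half_profile f b M \<psi> v"
    and x1: "0 \<le> x\<^sub>1" "x\<^sub>1 \<le> b" "\<psi> x\<^sub>1 = c"
    and below: "\<And>x. x \<in> {x\<^sub>1..b} \<Longrightarrow> \<psi> x \<le> c \<and> v x < 0"
    and m: "\<And>u. 0 \<le> u \<Longrightarrow> u \<le> c \<Longrightarrow> F M < F u"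
  shows "((\<lambda>u. 1 / sqrt (2 * (F u - F M))) has_integral (b - x\<^sub>1)) {0..c}"
proof -
  define g where "g u = 1 / sqrt (2 * (F u - F M))" for u
  define G where "G u = integral {0..u} g" for u
  have "continuous_on {0..c} g"
    unfolding g_def using m by (intro continuous_intros right_wellD(8)[OF well]) force
  then have dG: "(G has_real_derivative g u) (at u within {0..c})" if "u \<in> {0..c}" for u
    unfolding G_def using integral_has_real_derivative that by blast
  have der: "((\<lambda>x. G (\<psi> x) + x) has_real_derivative 0) (at x within {x\<^sub>1..b})"
    if x: "x \<in> {x\<^sub>1..b}" for x
  proof -
    have xb: "x \<in> {0..b}" using x x1 by auto
    have img: "\<psi> ` {x\<^sub>1..b} \<subseteq> {0..c}" using below half_profile_range[OF hp] x1(1) by auto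
    have "(\<psi> has_real_derivative v x) (at x within {x\<^sub>1..b})"
      using x x1 by (intro half_profile_derivs[OF hp]) auto
    then have "((G \<circ> \<psi>) has_real_derivative g (\<psi> x) * v x) (at x within {x\<^sub>1..b})"
      using img x by (intro DERIV_image_chain DERIV_subset[OF dG]) (auto simp: image_subset_iff)
    moreover have "sqrt (2 * (F (\<psi> x) - F M)) = - v x"
      using half_profile_energy[OF well hp xb] below[OF x] by (intro real_sqrt_unique) auto
    then have "g (\<psi> x) * v x = -1"
      using below[OF x] by (simp add: g_def)
    ultimately show ?thesis
      by (auto intro!: derivative_eq_intros simp: o_def)
  qed
  have "\<bar>(G (\<psi> b) + b) - (G (\<psi> x\<^sub>1) + x\<^sub>1)\<bar> \<le> 0 - 0"
    using growth_bound[OF x1(2) der, of "\<lambda>_. 0" "\<lambda>_. 0"] by simp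
  moreover have "G 0 = 0" by (simp add: G_def)
  moreover have "\<psi> b = 0" using hp unfolding half_profile_def by blast
  ultimately have "integral {0..c} g = b - x\<^sub>1"
    using x1(3) by (simp add: G_def)
  moreover have "g integrable_on {0..c}"
    using \<open>continuous_on {0..c} g\<close> by (rule integrable_continuous_real)
  ultimately show ?thesis
    by (simp add: has_integral_iff g_def[abs_def])
qed

lemma well_constants:
  assumes well: "right_well F f f'"
  obtains \<delta> m S where "0 < \<delta>" "\<delta> < 1" "mono_on {1 - \<delta>..1} f" "0 < m"
    "\<And>u. 0 \<le> u \<Longrightarrow> u \<le> 1 - \<delta> \<Longrightarrow> m \<le> F u" "0 < S" "\<And>u. 0 \<le> u \<Longrightarrow> u \<le> 1 \<Longrightarrow> 2 * F u \<le> S\<^sup>2"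
proof -
  note F_deriv = right_wellD(1)[OF well] and f_deriv = right_wellD(2)[OF well]
    and F_pos = right_wellD(7)[OF well]
  note F_cont = right_wellD(8)[OF well]
  have "\<forall>\<^sub>F u in nhds 1. f' u > 0"
    using right_wellD(3,6)[OF well] order_tendstoD(1)[of f' "f' 1" "nhds 1" 0]
    by (simp add: isCont_def tendsto_at_iff_tendsto_nhds)
  then obtain e where e: "0 < e" "\<And>u. dist u 1 < e \<Longrightarrow> f' u > 0"
    by (auto simp: eventually_nhds_metric)
  define \<delta> where "\<delta> = min (e / 2) (1 / 2)"
  have \<delta>: "0 < \<delta>" "\<delta> < 1" "\<delta> < e" using e by (auto simp: \<delta>_def)
  have "mono_on {1 - \<delta>..1} f"
  proof (rule mono_onI)
    fix r s assume rs: "r \<in> {1 - \<delta>..1}" "s \<in> {1 - \<delta>..1}" "r \<le> s"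
    show "f r \<le> f s"
    proof (rule DERIV_nonneg_imp_nondecreasing[OF rs(3)])
      fix x assume "r \<le> x" "x \<le> s"
      then have "f' x > 0" using rs \<delta> by (intro e) (auto simp: dist_real_def)
      then show "\<exists>y. (f has_real_derivative y) (at x) \<and> 0 \<le> y"
        using f_deriv less_imp_le by blast
    qed
  qed
  moreover obtain u\<^sub>0 where "u\<^sub>0 \<in> {0..1 - \<delta>}" "\<And>u. u \<in> {0..1 - \<delta>} \<Longrightarrow> F u\<^sub>0 \<le> F u"
    using continuous_attains_inf[of "{0..1 - \<delta>}" F] F_cont \<delta> by auto
  moreover obtain u\<^sub>1 where "\<And>u. u \<in> {0..1} \<Longrightarrow> F u \<le> F u\<^sub>1"
    using continuous_attains_sup[of "{0..1}" F] F_cont by fastforce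
  moreover have "F u\<^sub>1 \<ge> F 0" "F 0 > 0" using calculation(4)[of 0] F_pos[of 0] by auto
  ultimately show ?thesis
    using that[of \<delta> "F u\<^sub>0" "sqrt (2 * F u\<^sub>1)"] \<delta> F_pos[of u\<^sub>0] by force
qed

text \<open>
  The comparison in two stages: separation above the level \<open>1 - \<delta>\<close> makes the profile with the
  higher peak longer, and the difference of the transit times below that level is too small to
  compensate. Thus the length determines the peak, with a Lipschitz dependence.
\<close>

lemma peak_energy_lipschitz:
  assumes well: "right_well F f f'"
  obtains \<mu> K where "\<mu> < 1" "0 < K"
    "\<And>b\<^sub>1 M\<^sub>1 \<psi>\<^sub>1 v\<^sub>1 b\<^sub>2 M\<^sub>2 \<psi>\<^sub>2 v\<^sub>2. half_profile f b\<^sub>1 M\<^sub>1 \<psi>\<^sub>1 v\<^sub>1 \<Longrightarrow> half_profile f b\<^sub>2 M\<^sub>2 \<psi>\<^sub>2 v\<^sub>2 \<Longrightarrow>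
       \<mu> < M\<^sub>1 \<Longrightarrow> M\<^sub>1 < 1 \<Longrightarrow> \<mu> < M\<^sub>2 \<Longrightarrow> M\<^sub>2 < 1 \<Longrightarrow> \<bar>F M\<^sub>1 - F M\<^sub>2\<bar> \<le> K * \<bar>b\<^sub>1 - b\<^sub>2\<bar>"
proof -
  note F_deriv = right_wellD(1)[OF well] and f_deriv = right_wellD(2)[OF well]
    and F_pos = right_wellD(7)[OF well]
  note F_one = right_wellD(4)[OF well] and f_one = right_wellD(5)[OF well]
  obtain \<delta> m S where \<delta>: "0 < \<delta>" "\<delta> < 1" and mono: "mono_on {1 - \<delta>..1} f" and m: "0 < m"
    "\<And>u. 0 \<le> u \<Longrightarrow> u \<le> 1 - \<delta> \<Longrightarrow> m \<le> F u" and S: "0 < S" "\<And>u. 0 \<le> u \<Longrightarrow> u \<le> 1 \<Longrightarrow> 2 * F u \<le> S\<^sup>2"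
    using well_constants[OF well] by blast
  have f_le: "f u \<le> 0" if "1 - \<delta> \<le> u" "u \<le> 1" for u
    using mono_onD[OF mono, of u 1] that \<delta> f_one by auto
  \<comment> \<open>Close to \<open>1\<close> the slope of \<open>F\<close> is at most \<open>\<kappa>\<close>
    in size; with this value the profile with the higher peak gains below \<open>1 - \<delta>\<close> at most half
    of its delay above.\<close>
  define \<kappa> where "\<kappa> = m * sqrt m / (4 * S)"
  have \<kappa>: "0 < \<kappa>" using m S by (simp add: \<kappa>_def)
  have "\<forall>\<^sub>F u in nhds 1. \<bar>f u\<bar> < \<kappa> \<and> F u < m / 2"
  proof (rule eventually_conj)
    have "isCont f 1" "isCont F 1" using f_deriv F_deriv DERIV_isCont by blast+
    then have "(f \<longlongrightarrow> 0) (nhds 1)" "(F \<longlongrightarrow> 0) (nhds 1)"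
      using F_one f_one by (metis isCont_def tendsto_at_iff_tendsto_nhds)+
    then show "\<forall>\<^sub>F u in nhds 1. \<bar>f u\<bar> < \<kappa>" "\<forall>\<^sub>F u in nhds 1. F u < m / 2"
      using \<kappa> m tendstoD[of f 0 "nhds 1" \<kappa>] order_tendstoD(2)[of F 0 "nhds 1" "m / 2"] by auto
  qed
  then obtain e where e: "0 < e" "\<And>u. dist u 1 < e \<Longrightarrow> \<bar>f u\<bar> < \<kappa> \<and> F u < m / 2"
    by (auto simp: eventually_nhds_metric)
  \<comment> \<open>At peaks above \<open>\<mu>\<close> the slope of \<open>F\<close> is at most
    \<open>\<kappa>\<close> in size, and the energy is below half of the lower bound \<open>m\<close> of
    \<open>F\<close> on the transit range.\<close>
  define \<mu> where "\<mu> = max (1 - e) (1 - \<delta>)"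
  have \<mu>: "\<mu> < 1" "1 - \<delta> \<le> \<mu>" "0 < \<mu>" using e \<delta> by (auto simp: \<mu>_def)
  have near: "\<bar>f u\<bar> \<le> \<kappa>" "F u < m / 2" if "\<mu> < u" "u < 1" for u
    using e(2)[of u] that by (auto simp: \<mu>_def dist_real_def)
  have F_lip: "\<bar>F r - F s\<bar> \<le> \<kappa> * (s - r)" if "\<mu> < r" "r \<le> s" "s < 1" for r s
  proof -
    have "\<bar>F s - F r\<bar> \<le> \<kappa> * s - \<kappa> * r"
    proof (rule growth_bound[OF that(2), where p' = f and k' = "\<lambda>_. \<kappa>"])
      fix x assume x: "x \<in> {r..s}"
      show "(F has_real_derivative f x) (at x within {r..s})"
        using F_deriv has_field_derivative_at_within by blast
      show "((*) \<kappa> has_real_derivative \<kappa>) (at x within {r..s})"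
        by (auto intro!: derivative_eq_intros)
      show "\<bar>f x\<bar> \<le> \<kappa>" using near x that by auto
    qed
    then show ?thesis by (simp add: algebra_simps)
  qed
  have main: "M\<^sub>2 - M\<^sub>1 \<le> 2 * S * (b\<^sub>2 - b\<^sub>1)"
    if hp: "half_profile f b\<^sub>1 M\<^sub>1 \<psi>\<^sub>1 v\<^sub>1" "half_profile f b\<^sub>2 M\<^sub>2 \<psi>\<^sub>2 v\<^sub>2"
      and M: "\<mu> < M\<^sub>1" "M\<^sub>1 < M\<^sub>2" "M\<^sub>2 < 1" for b\<^sub>1 M\<^sub>1 \<psi>\<^sub>1 v\<^sub>1 b\<^sub>2 M\<^sub>2 \<psi>\<^sub>2 v\<^sub>2
  proof -
    note H = hp[unfolded half_profile_def]
    have FM: "F M\<^sub>1 < m / 2" "F M\<^sub>2 < m / 2" using near M by auto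
    have gap: "F M\<^sub>1 < F u" "F M\<^sub>2 < F u" if "0 \<le> u" "u \<le> 1 - \<delta>" for u
      using m(2)[OF that] FM m(1) by linarith+
    have peaks: "1 - \<delta> < M\<^sub>1" "M\<^sub>1 < 1" "1 - \<delta> < M\<^sub>2" "M\<^sub>2 < 1"
      using M \<mu> by auto
    obtain x\<^sub>1 where x1: "0 < x\<^sub>1" "x\<^sub>1 \<le> b\<^sub>1" "\<psi>\<^sub>1 x\<^sub>1 = 1 - \<delta>"
      "\<And>x. x \<in> {0..x\<^sub>1} \<Longrightarrow> 1 - \<delta> \<le> \<psi>\<^sub>1 x"
      "\<And>x. x \<in> {x\<^sub>1..b\<^sub>1} \<Longrightarrow> \<psi>\<^sub>1 x \<le> 1 - \<delta> \<and> v\<^sub>1 x < 0"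
      by (rule half_profile_descent[OF well hp(1) \<delta> peaks(1,2) f_le gap(1)]) blast+
    obtain x\<^sub>2 where x2: "0 < x\<^sub>2" "x\<^sub>2 \<le> b\<^sub>2" "\<psi>\<^sub>2 x\<^sub>2 = 1 - \<delta>"
      "\<And>x. x \<in> {0..x\<^sub>2} \<Longrightarrow> 1 - \<delta> \<le> \<psi>\<^sub>2 x"
      "\<And>x. x \<in> {x\<^sub>2..b\<^sub>2} \<Longrightarrow> \<psi>\<^sub>2 x \<le> 1 - \<delta> \<and> v\<^sub>2 x < 0"
      by (rule half_profile_descent[OF well hp(2) \<delta> peaks(3,4) f_le gap(2)]) blast+
    have sep: "M\<^sub>2 - M\<^sub>1 \<le> \<psi>\<^sub>2 (min x\<^sub>1 x\<^sub>2) - \<psi>\<^sub>1 (min x\<^sub>1 x\<^sub>2)"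
      using x1 x2 by (intro profiles_separate[OF hp M(2,3) _ _ _ mono]) auto
    have "x\<^sub>1 < x\<^sub>2"
    proof (rule ccontr)
      assume "\<not> x\<^sub>1 < x\<^sub>2"
      then show False using sep x2 x1(4)[of x\<^sub>2] M by auto
    qed
    then have sep': "M\<^sub>2 - M\<^sub>1 \<le> \<psi>\<^sub>2 x\<^sub>1 - (1 - \<delta>)" using sep x1 by simp
    have "\<bar>\<psi>\<^sub>2 x\<^sub>2 - \<psi>\<^sub>2 x\<^sub>1\<bar> \<le> S * x\<^sub>2 - S * x\<^sub>1"
    proof (rule growth_bound[where p' = v\<^sub>2 and k' = "\<lambda>_. S"])
      fix x assume x: "x \<in> {x\<^sub>1..x\<^sub>2}"
      then have xb: "x \<in> {0..b\<^sub>2}" using x1 x2 by auto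
      show "(\<psi>\<^sub>2 has_real_derivative v\<^sub>2 x) (at x within {x\<^sub>1..x\<^sub>2})"
        using x x1 x2 by (intro half_profile_derivs[OF hp(2)]) auto
      show "((*) S has_real_derivative S) (at x within {x\<^sub>1..x\<^sub>2})"
        by (auto intro!: derivative_eq_intros)
      have "0 \<le> \<psi>\<^sub>2 x" "\<psi>\<^sub>2 x \<le> 1" using half_profile_range[OF hp(2) xb] M(3) by auto
      moreover have "0 \<le> F M\<^sub>2" using F_pos[of M\<^sub>2] M \<mu> by simp
      ultimately have "(v\<^sub>2 x)\<^sup>2 \<le> S\<^sup>2"
        using half_profile_energy[OF well hp(2) xb] S(2)[of "\<psi>\<^sub>2 x"] by simp
      then show "\<bar>v\<^sub>2 x\<bar> \<le> S" using S(1) by (simp add: abs_le_square_iff[symmetric])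
    qed (use \<open>x\<^sub>1 < x\<^sub>2\<close> in simp)
    \<comment> \<open>The second profile has to cover at least \<open>M\<^sub>2 - M\<^sub>1\<close> between the
      times \<open>x\<^sub>1\<close> and \<open>x\<^sub>2\<close>, at speed at most \<open>S\<close>.\<close>
    then have upper: "M\<^sub>2 - M\<^sub>1 \<le> S * (x\<^sub>2 - x\<^sub>1)"
      using sep' x2(3) by (simp add: algebra_simps)
    have F12: "0 \<le> F M\<^sub>1 - F M\<^sub>2" "F M\<^sub>1 - F M\<^sub>2 \<le> \<kappa> * (M\<^sub>2 - M\<^sub>1)"
    proof -
      have "- F M\<^sub>1 \<le> - F M\<^sub>2"
      proof (rule within_mono[where p = "\<lambda>x. - F x" and p' = "\<lambda>x. - f x"])
        fix x assume "x \<in> {M\<^sub>1..M\<^sub>2}"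
        then show "0 \<le> - f x" using f_le[of x] M \<mu> by auto
      qed (use M F_deriv in \<open>auto intro!: DERIV_minus intro: has_field_derivative_at_within\<close>)
      then show "0 \<le> F M\<^sub>1 - F M\<^sub>2" by simp
      show "F M\<^sub>1 - F M\<^sub>2 \<le> \<kappa> * (M\<^sub>2 - M\<^sub>1)" using F_lip[of M\<^sub>1 M\<^sub>2] M by auto
    qed
    define d where "d = 2 * (F M\<^sub>1 - F M\<^sub>2) / (m * sqrt m)"
    have i1: "((\<lambda>u. 1 / sqrt (2 * (F u - F M\<^sub>1))) has_integral (b\<^sub>1 - x\<^sub>1)) {0..1 - \<delta>}"
      using x1 by (intro transit_time[OF well hp(1)] gap) auto
    have i2: "((\<lambda>u. 1 / sqrt (2 * (F u - F M\<^sub>2))) has_integral (b\<^sub>2 - x\<^sub>2)) {0..1 - \<delta>}"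
      using x2 by (intro transit_time[OF well hp(2)] gap) auto
    have "(b\<^sub>1 - x\<^sub>1) - (b\<^sub>2 - x\<^sub>2) \<le> d * (1 - \<delta>)"
    proof (rule has_integral_le[OF has_integral_diff[OF i1 i2]])
      show "((\<lambda>_. d) has_integral d * (1 - \<delta>)) {0..1 - \<delta>}"
        using has_integral_const_real[of d 0 "1 - \<delta>"] \<delta> by (simp add: mult.commute)
      fix u assume "u \<in> {0..1 - \<delta>}"
      then have "m \<le> F u" using m by auto
      then have "1 / sqrt (2 * (F u - F M\<^sub>1)) - 1 / sqrt (2 * (F u - F M\<^sub>2))
          \<le> (2 * (F u - F M\<^sub>2) - 2 * (F u - F M\<^sub>1)) / (m * sqrt m)"
        using FM F12 m(1) by (intro inverse_sqrt_diff_le) auto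
      then show "1 / sqrt (2 * (F u - F M\<^sub>1)) - 1 / sqrt (2 * (F u - F M\<^sub>2)) \<le> d"
        by (simp add: d_def algebra_simps)
    qed
    also have "\<dots> \<le> d * 1"
      using F12 m(1) \<delta> by (intro mult_left_mono) (auto simp: d_def)
    also have "\<dots> \<le> 2 * (\<kappa> * (M\<^sub>2 - M\<^sub>1)) / (m * sqrt m)"
      unfolding d_def using F12 m(1) by (simp add: divide_right_mono)
    also have "\<dots> = (M\<^sub>2 - M\<^sub>1) / (2 * S)"
      using m(1) S by (simp add: \<kappa>_def field_simps)
    finally have "S * ((b\<^sub>1 - x\<^sub>1) - (b\<^sub>2 - x\<^sub>2)) \<le> S * ((M\<^sub>2 - M\<^sub>1) / (2 * S))"
      using S by (intro mult_left_mono) auto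
    also have "\<dots> = (M\<^sub>2 - M\<^sub>1) / 2" using S by simp
    finally show ?thesis
      using upper by (simp add: right_diff_distrib)
  qed
  show ?thesis
  proof (rule that[of \<mu> "2 * S * \<kappa>"])
    fix b\<^sub>1 M\<^sub>1 \<psi>\<^sub>1 v\<^sub>1 b\<^sub>2 M\<^sub>2 \<psi>\<^sub>2 v\<^sub>2
    assume hp: "half_profile f b\<^sub>1 M\<^sub>1 \<psi>\<^sub>1 v\<^sub>1" "half_profile f b\<^sub>2 M\<^sub>2 \<psi>\<^sub>2 v\<^sub>2"
      and M: "\<mu> < M\<^sub>1" "M\<^sub>1 < 1" "\<mu> < M\<^sub>2" "M\<^sub>2 < 1"
    have "\<bar>M\<^sub>1 - M\<^sub>2\<bar> \<le> 2 * S * \<bar>b\<^sub>1 - b\<^sub>2\<bar>"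
    proof (cases M\<^sub>1 M\<^sub>2 rule: linorder_cases)
      case less
      have "2 * S * (b\<^sub>2 - b\<^sub>1) \<le> 2 * S * \<bar>b\<^sub>1 - b\<^sub>2\<bar>" using S by (intro mult_left_mono) auto
      then show ?thesis using main[OF hp] less M by auto
    next
      case greater
      have "2 * S * (b\<^sub>1 - b\<^sub>2) \<le> 2 * S * \<bar>b\<^sub>1 - b\<^sub>2\<bar>" using S by (intro mult_left_mono) auto
      then show ?thesis using main[OF hp(2,1)] greater M by auto
    qed (use S in auto)
    then have "\<kappa> * \<bar>M\<^sub>1 - M\<^sub>2\<bar> \<le> \<kappa> * (2 * S * \<bar>b\<^sub>1 - b\<^sub>2\<bar>)"
      using \<kappa> by (intro mult_left_mono) auto
    moreover have "\<bar>F M\<^sub>1 - F M\<^sub>2\<bar> \<le> \<kappa> * \<bar>M\<^sub>1 - M\<^sub>2\<bar>"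
      using F_lip[of M\<^sub>1 M\<^sub>2] F_lip[of M\<^sub>2 M\<^sub>1] M by (cases "M\<^sub>1 \<le> M\<^sub>2") auto
    ultimately show "\<bar>F M\<^sub>1 - F M\<^sub>2\<bar> \<le> 2 * S * \<kappa> * \<bar>b\<^sub>1 - b\<^sub>2\<bar>"
      by (simp add: mult_ac)
  qed (use \<mu> S \<kappa> in auto)
qed

text \<open>
  The peak of \<open>\<bar>\<phi>\<bar>\<close> at the origin is what makes the derivative vanish there, so that the half
  profile starts at rest. Multiplication by \<open>\<sigma>\<close> makes the profile positive and reflects the
  potential.
\<close>

lemma steady_profile_half_profile:
  assumes sp: "steady_profile F 1 l \<sigma> \<phi>" and \<sigma>: "\<sigma> \<in> {1, -1}" and l: "0 < l"
  obtains v where "half_profile (\<lambda>u. \<sigma> * deriv F (\<sigma> * u)) (l / 2) \<bar>\<phi> 0\<bar> (\<lambda>x. \<sigma> * \<phi> x) v"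
proof -
  let ?I = "{- l / 2..l / 2}"
  obtain \<phi>x \<phi>xx where d0: "\<forall>x\<in>?I. (\<phi> has_real_derivative \<phi>x x) (at x within ?I) \<and>
      (\<phi>x has_real_derivative \<phi>xx x) (at x within ?I) \<and> - 1\<^sup>2 * \<phi>xx x + deriv F (\<phi> x) = 0"
    using sp unfolding steady_profile_def by blast
  have d: "(\<phi> has_real_derivative \<phi>x x) (at x within ?I)"
      "(\<phi>x has_real_derivative \<phi>xx x) (at x within ?I)" "\<phi>xx x = deriv F (\<phi> x)"
    if "x \<in> ?I" for x
    using d0[rule_format, OF that] by simp_all
  have bc: "\<phi> (l / 2) = 0" and pos: "\<And>x. x \<in> {- l / 2<..<l / 2} \<Longrightarrow> \<sigma> * \<phi> x > 0"
    and top: "\<And>x. x \<in> ?I \<Longrightarrow> \<bar>\<phi> x\<bar> \<le> \<bar>\<phi> 0\<bar>"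
    using sp unfolding steady_profile_def by blast+
  have abs_eq: "\<bar>\<phi> x\<bar> = \<bar>\<sigma> * \<phi> x\<bar>" for x using \<sigma> by auto
  have peak: "\<sigma> * \<phi> 0 = \<bar>\<phi> 0\<bar>" using pos[of 0] l abs_eq[of 0] by simp
  have sq: "\<sigma> * (\<sigma> * u) = u" for u using \<sigma> by auto
  have sub: "{0..l / 2} \<subseteq> ?I" using l by auto
  have der: "((\<lambda>x. \<sigma> * \<phi> x) has_real_derivative \<sigma> * \<phi>x x) (at x within ?I)" if "x \<in> ?I" for x
    using d(1)[OF that] by (rule DERIV_cmult)
  have der2: "((\<lambda>x. \<sigma> * \<phi>x x) has_real_derivative \<sigma> * \<phi>xx x) (at x within ?I)" if "x \<in> ?I" for x
    using d(2)[OF that] by (rule DERIV_cmult)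
  have "\<sigma> * \<phi>x 0 = 0"
  proof (rule DERIV_local_max[where d = "l / 2"])
    have "(at 0 within ?I) = at 0"
      using l by (intro at_within_interior) auto
    then show "((\<lambda>x. \<sigma> * \<phi> x) has_real_derivative \<sigma> * \<phi>x 0) (at 0)"
      using der[of 0] l by simp
    show "\<forall>y. \<bar>0 - y\<bar> < l / 2 \<longrightarrow> \<sigma> * \<phi> y \<le> \<sigma> * \<phi> 0"
    proof (intro allI impI)
      fix y assume "\<bar>0 - y\<bar> < l / 2"
      then have "\<bar>\<phi> y\<bar> \<le> \<bar>\<phi> 0\<bar>" by (intro top) auto
      then show "\<sigma> * \<phi> y \<le> \<sigma> * \<phi> 0" using abs_eq[of y] peak by linarith
    qed
  qed (use l in simp)
  moreover have "0 \<le> \<sigma> * \<phi> x" "\<sigma> * \<phi> x \<le> \<bar>\<phi> 0\<bar>" if "x \<in> {0..l / 2}" for x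
  proof -
    show "0 \<le> \<sigma> * \<phi> x" using pos[of x] bc that l by (cases "x = l / 2") auto
    show "\<sigma> * \<phi> x \<le> \<bar>\<phi> 0\<bar>" using top[of x] sub that abs_eq[of x] by force
  qed
  moreover have "((\<lambda>x. \<sigma> * \<phi> x) has_real_derivative \<sigma> * \<phi>x x) (at x within {0..l / 2})"
    "((\<lambda>x. \<sigma> * \<phi>x x) has_real_derivative \<sigma> * deriv F (\<sigma> * (\<sigma> * \<phi> x))) (at x within {0..l / 2})"
    if "x \<in> {0..l / 2}" for x
    using DERIV_subset[OF der sub] DERIV_subset[OF der2 sub] d(3) that sub by (auto simp: sq)
  ultimately have "half_profile (\<lambda>u. \<sigma> * deriv F (\<sigma> * u)) (l / 2) \<bar>\<phi> 0\<bar>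
      (\<lambda>x. \<sigma> * \<phi> x) (\<lambda>x. \<sigma> * \<phi>x x)"
    unfolding half_profile_def using l peak bc by auto
  then show ?thesis using that by blast
qed

lemma double_well_right_well:
  assumes "double_well F" and \<sigma>: "\<sigma> \<in> {1, -1}"
  shows "right_well (\<lambda>u. F (\<sigma> * u)) (\<lambda>u. \<sigma> * deriv F (\<sigma> * u)) (\<lambda>u. deriv (deriv F) (\<sigma> * u))"
proof -
  have diff: "(deriv ^^ k) F field_differentiable at u" if "k < 3" for k u
    using assms(1) that by (simp add: double_well_def C_k_def)
  have d1: "(F has_real_derivative deriv F u) (at u)" for u
    using diff[of 0 u] field_differentiable_derivI by fastforce
  have d2: "(deriv F has_real_derivative deriv (deriv F) u) (at u)" for u
    using diff[of 1 u] field_differentiable_derivI by fastforce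
  have c2: "isCont (deriv (deriv F)) u" for u
    using diff[of 2 u] field_differentiable_imp_continuous_at by (auto simp: numeral_2_eq_2)
  have sq: "\<sigma> * (u * \<sigma>) = u" for u using \<sigma> by auto
  have lin: "((*) \<sigma> has_real_derivative \<sigma>) (at u)" for u
    by (auto intro!: derivative_eq_intros)
  show ?thesis
    unfolding right_well_def
  proof (intro conjI allI impI)
    fix u
    show "((\<lambda>u. F (\<sigma> * u)) has_real_derivative \<sigma> * deriv F (\<sigma> * u)) (at u)"
      using DERIV_chain2[OF d1 lin, of u] by (simp only: mult.commute[of \<sigma>])
    show "((\<lambda>u. \<sigma> * deriv F (\<sigma> * u)) has_real_derivative deriv (deriv F) (\<sigma> * u)) (at u)"
      using DERIV_cmult[OF DERIV_chain2[OF d2 lin], of \<sigma> u] by (simp only: sq)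
    show "isCont (\<lambda>u. deriv (deriv F) (\<sigma> * u)) 1"
      by (intro isCont_o2[OF _ c2] continuous_intros)
    show "F (\<sigma> * 1) = 0" "\<sigma> * deriv F (\<sigma> * 1) = 0" "0 < deriv (deriv F) (\<sigma> * 1)"
      using assms by (auto simp: double_well_def)
    assume "0 \<le> u" "u < 1"
    then show "0 < F (\<sigma> * u)"
      using assms by (auto simp: double_well_def)
  qed
qed

text \<open>
  The peak value depends only on \<open>\<epsilon> / l\<close>, so everything reduces to \<open>\<epsilon> = 1\<close>. This is why neither
  \<open>\<rho>\<^sub>0\<close> nor \<open>K\<close> depends on \<open>\<epsilon>\<close>. A small \<open>\<rho>\<^sub>0\<close> forces long intervals, hence peaks close
  to \<open>1\<close>.
\<close>

lemma peak_energy_lipschitz_in_length: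
  assumes dw: "double_well F" and pf: "profile_family F L0 \<phi>" and \<sigma>: "\<sigma> \<in> {1, -1}"
  obtains \<rho>\<^sub>0 K where "0 < \<rho>\<^sub>0" "0 < K"
    "\<And>\<epsilon> \<rho> l l'. 0 < \<epsilon> \<Longrightarrow> 0 < \<rho> \<Longrightarrow> \<rho> < \<rho>\<^sub>0 \<Longrightarrow> \<rho> < 1 / L0 \<Longrightarrow> \<epsilon> / \<rho> < l \<Longrightarrow> \<epsilon> / \<rho> < l' \<Longrightarrow>
       \<bar>alpha F \<phi> \<epsilon> \<sigma> (\<epsilon> / l) - alpha F \<phi> \<epsilon> \<sigma> (\<epsilon> / l')\<bar> \<le> K / \<epsilon> * \<bar>l - l'\<bar>"
proof -
  define f\<^sub>\<sigma> where "f\<^sub>\<sigma> = (\<lambda>u. \<sigma> * deriv F (\<sigma> * u))"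
  have well: "right_well (\<lambda>u. F (\<sigma> * u)) f\<^sub>\<sigma> (\<lambda>u. deriv (deriv F) (\<sigma> * u))"
    using double_well_right_well[OF dw \<sigma>] by (simp add: f\<^sub>\<sigma>_def)
  obtain \<mu> K where \<mu>: "\<mu> < 1" and K: "0 < K"
    "\<And>b\<^sub>1 M\<^sub>1 \<psi>\<^sub>1 v\<^sub>1 b\<^sub>2 M\<^sub>2 \<psi>\<^sub>2 v\<^sub>2. half_profile f\<^sub>\<sigma> b\<^sub>1 M\<^sub>1 \<psi>\<^sub>1 v\<^sub>1 \<Longrightarrow> half_profile f\<^sub>\<sigma> b\<^sub>2 M\<^sub>2 \<psi>\<^sub>2 v\<^sub>2 \<Longrightarrow>
       \<mu> < M\<^sub>1 \<Longrightarrow> M\<^sub>1 < 1 \<Longrightarrow> \<mu> < M\<^sub>2 \<Longrightarrow> M\<^sub>2 < 1 \<Longrightarrow>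
       \<bar>F (\<sigma> * M\<^sub>1) - F (\<sigma> * M\<^sub>2)\<bar> \<le> K * \<bar>b\<^sub>1 - b\<^sub>2\<bar>"
    using peak_energy_lipschitz[OF well] by blast
  have L0: "0 < L0" using pf by (simp add: profile_family_def)
  have prof: "steady_profile F 1 l \<sigma> (\<lambda>x. \<phi> 1 x l \<sigma>)" if "L0 < l" for l
    using pf \<sigma> that unfolding profile_family_def by (metis mult_1 zero_less_one)
  have scale: "\<phi> \<epsilon> 0 l \<sigma> = \<phi> 1 0 (l / \<epsilon>) \<sigma>" if "0 < \<epsilon>" "\<epsilon> * L0 < l" for \<epsilon> l
  proof -
    have "1 * L0 < l / \<epsilon>" "\<epsilon> / l = 1 / (l / \<epsilon>)" using that by (auto simp: field_simps)
    then show ?thesis using pf \<sigma> that unfolding profile_family_def by (metis zero_less_one)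
  qed
  have "((\<lambda>r. \<bar>\<phi> 1 0 (1 / r) \<sigma>\<bar>) \<longlongrightarrow> 1) (at_right 0)"
    using pf \<sigma> unfolding profile_family_def by (metis zero_less_one)
  then have "\<forall>\<^sub>F r in at_right 0. \<mu> < \<bar>\<phi> 1 0 (1 / r) \<sigma>\<bar>"
    using \<mu> by (rule order_tendstoD)
  then obtain \<rho>\<^sub>0 where \<rho>0: "0 < \<rho>\<^sub>0" "\<And>r. 0 < r \<Longrightarrow> r < \<rho>\<^sub>0 \<Longrightarrow> \<mu> < \<bar>\<phi> 1 0 (1 / r) \<sigma>\<bar>"
    by (auto simp: eventually_at_right_field)
  have unit: "\<bar>F (\<phi> 1 0 l \<sigma>) - F (\<phi> 1 0 l' \<sigma>)\<bar> \<le> K * \<bar>l / 2 - l' / 2\<bar>"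
    if l: "1 / \<rho> < l" "1 / \<rho> < l'" and \<rho>: "0 < \<rho>" "\<rho> < \<rho>\<^sub>0" "\<rho> < 1 / L0" for l l' \<rho>
  proof -
    have ex: "\<exists>v. half_profile f\<^sub>\<sigma> (l / 2) \<bar>\<phi> 1 0 l \<sigma>\<bar> (\<lambda>x. \<sigma> * \<phi> 1 x l \<sigma>) v \<and>
        \<mu> < \<bar>\<phi> 1 0 l \<sigma>\<bar> \<and> \<bar>\<phi> 1 0 l \<sigma>\<bar> < 1 \<and> \<sigma> * \<bar>\<phi> 1 0 l \<sigma>\<bar> = \<phi> 1 0 l \<sigma>" if "1 / \<rho> < l" for l
    proof -
      have "L0 < 1 / \<rho>" using \<rho> L0 by (simp add: field_simps)
      then have l: "L0 < l" "0 < l" using that L0 by auto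
      have "1 / l < \<rho>" using that l \<rho> by (simp add: field_simps)
      then have "\<mu> < \<bar>\<phi> 1 0 l \<sigma>\<bar>" using \<rho>0(2)[of "1 / l"] l \<rho> by simp
      moreover have "0 < \<sigma> * \<phi> 1 0 l \<sigma>" "\<bar>\<phi> 1 0 l \<sigma>\<bar> < 1"
        using prof[OF l(1)] l by (auto simp: steady_profile_def)
      moreover from this(1) have "\<sigma> * \<bar>\<phi> 1 0 l \<sigma>\<bar> = \<phi> 1 0 l \<sigma>" using \<sigma> by auto
      ultimately show ?thesis
        using steady_profile_half_profile[OF prof[OF l(1)] \<sigma> l(2)] f\<^sub>\<sigma>_def
        by metis
    qed
    show ?thesis
      using ex[OF l(1)] ex[OF l(2)] K(2) by metis
  qed
  show ?thesis
  proof (rule that[OF \<rho>0(1), of "K / 2"])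
    fix \<epsilon> \<rho> l l' :: real
    assume \<epsilon>: "0 < \<epsilon>" and \<rho>: "0 < \<rho>" "\<rho> < \<rho>\<^sub>0" "\<rho> < 1 / L0" and l: "\<epsilon> / \<rho> < l" "\<epsilon> / \<rho> < l'"
    have alpha: "alpha F \<phi> \<epsilon> \<sigma> (\<epsilon> / l) = F (\<phi> 1 0 (l / \<epsilon>) \<sigma>) \<and> 1 / \<rho> < l / \<epsilon>" if "\<epsilon> / \<rho> < l" for l
    proof -
      have "0 < \<epsilon> / \<rho>" using \<epsilon> \<rho> by simp
      then have "0 < l" using that by linarith
      have "\<epsilon> * L0 < \<epsilon> / \<rho>" using \<epsilon> \<rho> L0 by (simp add: field_simps)
      then have "\<phi> \<epsilon> 0 l \<sigma> = \<phi> 1 0 (l / \<epsilon>) \<sigma>" using \<epsilon> that by (intro scale) auto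
      moreover have "1 / \<rho> < l / \<epsilon>" using \<epsilon> that \<rho> by (simp add: field_simps)
      ultimately show ?thesis
        using \<epsilon> \<open>0 < l\<close> by (simp add: alpha_def)
    qed
    have "\<bar>F (\<phi> 1 0 (l / \<epsilon>) \<sigma>) - F (\<phi> 1 0 (l' / \<epsilon>) \<sigma>)\<bar> \<le> K * \<bar>l / \<epsilon> / 2 - l' / \<epsilon> / 2\<bar>"
      using alpha l \<rho> by (intro unit) auto
    also have "l / \<epsilon> / 2 - l' / \<epsilon> / 2 = (l - l') / (2 * \<epsilon>)"
      by (simp add: diff_divide_distrib)
    finally show "\<bar>alpha F \<phi> \<epsilon> \<sigma> (\<epsilon> / l) - alpha F \<phi> \<epsilon> \<sigma> (\<epsilon> / l')\<bar> \<le> K / 2 / \<epsilon> * \<bar>l - l'\<bar>"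
      using alpha l \<epsilon> by (simp add: abs_divide)
  qed (use K in simp)
qed

section \<open>Lipschitz continuity of the driving field\<close>

lemma vdist_nonneg [simp]: "0 \<le> vdist N x y"
  by (simp add: vdist_def L2_set_nonneg)

lemma component_le_vdist: "j \<in> {1..N} \<Longrightarrow> \<bar>x j - y j\<bar> \<le> vdist N x y"
  using member_le_L2_set[of "{1..N}" j "\<lambda>j. \<bar>x j - y j\<bar>"] by (simp add: vdist_def L2_set_def)

text \<open>
  The factor \<open>N\<close>, from the comparison with the sum norm, is not optimal; it allows all
  differential inequalities to be treated one component at a time.
\<close>

lemma vdist_le:
  assumes "\<And>j. j \<in> {1..N} \<Longrightarrow> \<bar>x j - y j\<bar> \<le> c"
  shows "vdist N x y \<le> real N * c"
proof -
  have "vdist N x y \<le> (\<Sum>j\<in>{1..N}. \<bar>x j - y j\<bar>)"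
    unfolding vdist_def by (rule L2_set_le_sum_abs)
  also have "\<dots> \<le> real N * c"
    using sum_bounded_above[of "{1..N}" "\<lambda>j. \<bar>x j - y j\<bar>" c] assms by simp
  finally show ?thesis .
qed

lemma vdist_continuous_on:
  assumes "\<And>j. j \<in> {1..N} \<Longrightarrow> continuous_on S (\<lambda>t. x t j)"
    and "\<And>j. j \<in> {1..N} \<Longrightarrow> continuous_on S (\<lambda>t. y t j)"
  shows "continuous_on S (\<lambda>t. vdist N (x t) (y t))"
  unfolding vdist_def L2_set_def using assms by (intro continuous_intros) auto

definition lipschitz_field :: "nat \<Rightarrow> (nat \<Rightarrow> real) set \<Rightarrow> real \<Rightarrow> ((nat \<Rightarrow> real) \<Rightarrow> nat \<Rightarrow> real) \<Rightarrow> bool" where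
  "lipschitz_field N \<Omega> L P \<longleftrightarrow>
     (\<forall>x\<in>\<Omega>. \<forall>y\<in>\<Omega>. \<forall>j\<in>{1..N}. \<bar>P x j - P y j\<bar> \<le> L * vdist N x y)"

lemma ext_diff_le:
  assumes "1 \<le> N" "j \<le> N + 1"
  shows "\<bar>ext N x j - ext N y j\<bar> \<le> vdist N x y"
proof -
  have "\<bar>x i - y i\<bar> \<le> vdist N x y" if "1 \<le> i" "i \<le> N" for i
    using that by (intro component_le_vdist) auto
  from this[of 1] this[of N] this[of j] show ?thesis
    using assms by (auto simp: ext_def)
qed

text \<open>
  Each component of the field involves the lengths of two neighbouring intervals, which are
  bounded below by \<open>\<epsilon> / \<rho>\<close> on \<open>\<Omega>\<^sub>\<rho>\<close>; the reflected end points cause at most the same change as the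
  layers that they reflect.
\<close>

lemma P_star_lipschitz:
  assumes dw: "double_well F" and pf: "profile_family F L0 \<phi>"
  obtains \<rho>\<^sub>0 where "0 < \<rho>\<^sub>0" "\<rho>\<^sub>0 \<le> 1 / L0"
    "\<And>(N::nat) \<epsilon> \<rho>. 1 \<le> N \<Longrightarrow> 0 < \<epsilon> \<Longrightarrow> 0 < \<rho> \<Longrightarrow> \<rho> < \<rho>\<^sub>0 \<Longrightarrow>
       \<exists>L>0. lipschitz_field N (Omega N \<epsilon> \<rho>) L (P_star F \<phi> \<epsilon> N)"
proof -
  obtain r\<^sub>1 K\<^sub>1 where 1: "0 < r\<^sub>1" "0 < K\<^sub>1"
    "\<And>\<epsilon> \<rho> l l'. 0 < \<epsilon> \<Longrightarrow> 0 < \<rho> \<Longrightarrow> \<rho> < r\<^sub>1 \<Longrightarrow> \<rho> < 1 / L0 \<Longrightarrow> \<epsilon> / \<rho> < l \<Longrightarrow> \<epsilon> / \<rho> < l' \<Longrightarrow>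
       \<bar>alpha F \<phi> \<epsilon> 1 (\<epsilon> / l) - alpha F \<phi> \<epsilon> 1 (\<epsilon> / l')\<bar> \<le> K\<^sub>1 / \<epsilon> * \<bar>l - l'\<bar>"
    using peak_energy_lipschitz_in_length[OF assms, of 1] by auto
  obtain r\<^sub>2 K\<^sub>2 where 2: "0 < r\<^sub>2" "0 < K\<^sub>2"
    "\<And>\<epsilon> \<rho> l l'. 0 < \<epsilon> \<Longrightarrow> 0 < \<rho> \<Longrightarrow> \<rho> < r\<^sub>2 \<Longrightarrow> \<rho> < 1 / L0 \<Longrightarrow> \<epsilon> / \<rho> < l \<Longrightarrow> \<epsilon> / \<rho> < l' \<Longrightarrow>
       \<bar>alpha F \<phi> \<epsilon> (-1) (\<epsilon> / l) - alpha F \<phi> \<epsilon> (-1) (\<epsilon> / l')\<bar> \<le> K\<^sub>2 / \<epsilon> * \<bar>l - l'\<bar>"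
    using peak_energy_lipschitz_in_length[OF assms, of "-1"] by auto
  have L0: "0 < L0" using pf by (simp add: profile_family_def)
  show ?thesis
  proof (rule that[of "min (1 / L0) (min r\<^sub>1 r\<^sub>2)"])
    fix N :: nat and \<epsilon> \<rho> :: real
    assume N: "1 \<le> N" and \<epsilon>: "0 < \<epsilon>" and \<rho>: "0 < \<rho>" "\<rho> < min (1 / L0) (min r\<^sub>1 r\<^sub>2)"
    define K where "K = max K\<^sub>1 K\<^sub>2 / \<epsilon>"
    have K: "0 < K" "K\<^sub>1 / \<epsilon> \<le> K" "K\<^sub>2 / \<epsilon> \<le> K"
      using 1 2 \<epsilon> by (auto simp: K_def intro!: divide_right_mono)
    have half: "\<bar>alpha_half F \<phi> \<epsilon> N x j - alpha_half F \<phi> \<epsilon> N y j\<bar> \<le> K * (2 * vdist N x y)"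
      if xy: "x \<in> Omega N \<epsilon> \<rho>" "y \<in> Omega N \<epsilon> \<rho>" and j: "j \<le> N" for x y j
    proof -
      define l where "l x = ext N x (j + 1) - ext N x j" for x
      have "\<epsilon> / \<rho> < l z" if "z \<in> Omega N \<epsilon> \<rho>" for z
      proof -
        have "\<forall>i\<in>{1..N + 1}. ext N z i - ext N z (i - 1) > \<epsilon> / \<rho>"
          using that unfolding Omega_def by blast
        from bspec[OF this, of "j + 1"] show ?thesis using j by (simp add: l_def)
      qed
      then have l: "\<epsilon> / \<rho> < l x" "\<epsilon> / \<rho> < l y" using xy by blast+
      have "\<bar>alpha_half F \<phi> \<epsilon> N x j - alpha_half F \<phi> \<epsilon> N y j\<bar> \<le> K * \<bar>l x - l y\<bar>"
      proof (cases "odd j")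
        case True
        have "K\<^sub>1 / \<epsilon> * \<bar>l x - l y\<bar> \<le> K * \<bar>l x - l y\<bar>" using K by (intro mult_right_mono) auto
        then show ?thesis
          using 1(3)[OF \<epsilon> \<rho>(1) _ _ l] \<rho>(2) True by (simp add: alpha_half_def l_def)
      next
        case False
        have "K\<^sub>2 / \<epsilon> * \<bar>l x - l y\<bar> \<le> K * \<bar>l x - l y\<bar>" using K by (intro mult_right_mono) auto
        then show ?thesis
          using 2(3)[OF \<epsilon> \<rho>(1) _ _ l] \<rho>(2) False by (simp add: alpha_half_def l_def)
      qed
      also have "\<dots> \<le> K * (2 * vdist N x y)"
        using ext_diff_le[OF N, of j x y] ext_diff_le[OF N, of "j + 1" x y] j K(1)
        by (intro mult_left_mono) (auto simp: l_def)
      finally show ?thesis .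
    qed
    define L where "L = \<bar>\<epsilon> / D_inf F\<bar> * (4 * K) + 1"
    have "lipschitz_field N (Omega N \<epsilon> \<rho>) L (P_star F \<phi> \<epsilon> N)"
      unfolding lipschitz_field_def
    proof (intro ballI)
      fix x y j assume xy: "x \<in> Omega N \<epsilon> \<rho>" "y \<in> Omega N \<epsilon> \<rho>" and j: "j \<in> {1..N}"
      let ?a = "alpha_half F \<phi> \<epsilon> N"
      have "P_star F \<phi> \<epsilon> N x j - P_star F \<phi> \<epsilon> N y j =
          \<epsilon> / D_inf F * ((?a x j - ?a y j) - (?a x (j - 1) - ?a y (j - 1)))"
        by (simp add: P_star_def algebra_simps)
      then have "\<bar>P_star F \<phi> \<epsilon> N x j - P_star F \<phi> \<epsilon> N y j\<bar> =
          \<bar>\<epsilon> / D_inf F\<bar> * \<bar>(?a x j - ?a y j) - (?a x (j - 1) - ?a y (j - 1))\<bar>"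
        by (simp only: abs_mult)
      also have "\<dots> \<le> \<bar>\<epsilon> / D_inf F\<bar> * (4 * K * vdist N x y)"
      proof (rule mult_left_mono)
        have "j - 1 \<le> N" "j \<le> N" using j by auto
        from this[THEN half[OF xy]]
        show "\<bar>(?a x j - ?a y j) - (?a x (j - 1) - ?a y (j - 1))\<bar> \<le> 4 * K * vdist N x y"
          by (simp add: abs_le_iff)
      qed simp
      also have "\<dots> \<le> L * vdist N x y"
        by (simp add: L_def algebra_simps)
      finally show "\<bar>P_star F \<phi> \<epsilon> N x j - P_star F \<phi> \<epsilon> N y j\<bar> \<le> L * vdist N x y" .
    qed
    moreover have "0 < L" using K by (simp add: L_def add_nonneg_pos)
    ultimately show "\<exists>L>0. lipschitz_field N (Omega N \<epsilon> \<rho>) L (P_star F \<phi> \<epsilon> N)" by blast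
  qed (use 1 2 L0 in auto)
qed

section \<open>The relaxation estimate\<close>

text \<open>
  The solution of \<open>\<tau> y' = q - \<gamma> y\<close> forgets its initial value at rate \<open>\<gamma> / \<tau>\<close> and follows
  \<open>q / \<gamma>\<close>. The target \<open>q\<close> is allowed to deviate from \<open>\<gamma> c\<close> linearly in the time left until \<open>t\<close>:
  by the fast forgetting such a drift costs only a factor \<open>\<tau>\<close>. The majorant \<open>?k\<close> in the proof is
  an antiderivative of \<open>e\<^bsup>\<gamma>s/\<tau>\<^esup> (a + b (t - s)) / \<tau>\<close>.
\<close>

lemma linear_relaxation:
  fixes y q :: "real \<Rightarrow> real"
  assumes "0 < \<tau>" "0 < \<gamma>" "0 \<le> t" "0 \<le> a" "0 \<le> b"
    and der: "\<And>s. s \<in> {0..t} \<Longrightarrow> (y has_real_derivative y' s) (at s within {0..t})"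
    and ode: "\<And>s. s \<in> {0..t} \<Longrightarrow> \<tau> * y' s = q s - \<gamma> * y s"
    and q: "\<And>s. s \<in> {0..t} \<Longrightarrow> \<bar>q s - \<gamma> * c\<bar> \<le> a + b * (t - s)"
  shows "\<bar>y t - c\<bar> \<le> exp (- \<gamma> * t / \<tau>) * \<bar>y 0 - c\<bar> + a / \<gamma> + b * \<tau> / \<gamma>\<^sup>2"
proof -
  let ?e = "\<lambda>s. exp (\<gamma> * s / \<tau>)"
  let ?p = "\<lambda>s. ?e s * (y s - c)"
  let ?k = "\<lambda>s. ?e s * (a / \<gamma> + b * (t - s) / \<gamma> + b * \<tau> / \<gamma>\<^sup>2)"
  have "\<bar>?p t - ?p 0\<bar> \<le> ?k t - ?k 0"
  proof (rule growth_bound[where p' = "\<lambda>s. ?e s * (q s - \<gamma> * c) / \<tau>"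
        and k' = "\<lambda>s. ?e s * (a + b * (t - s)) / \<tau>"])
    fix s assume s: "s \<in> {0..t}"
    have y': "y' s = (q s - \<gamma> * y s) / \<tau>" using ode[OF s] assms(1) by (simp add: field_simps)
    show "(?p has_real_derivative ?e s * (q s - \<gamma> * c) / \<tau>) (at s within {0..t})"
      using assms(1) by (auto intro!: derivative_eq_intros der[OF s] simp: y' field_simps)
    show "(?k has_real_derivative ?e s * (a + b * (t - s)) / \<tau>) (at s within {0..t})"
      using assms(1,2) by (auto intro!: derivative_eq_intros simp: field_simps power2_eq_square)
    show "\<bar>?e s * (q s - \<gamma> * c) / \<tau>\<bar> \<le> ?e s * (a + b * (t - s)) / \<tau>"
      using q[OF s] assms(1) by (simp add: abs_mult divide_right_mono)
  qed (use assms in simp)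
  moreover have "0 \<le> ?k 0" using assms by simp
  moreover have "\<bar>?p t\<bar> = ?e t * \<bar>y t - c\<bar>" "\<bar>?p 0\<bar> = \<bar>y 0 - c\<bar>"
    by (simp_all add: abs_mult)
  ultimately have "?e t * \<bar>y t - c\<bar> \<le> \<bar>y 0 - c\<bar> + ?e t * (a / \<gamma> + b * \<tau> / \<gamma>\<^sup>2)"
    by simp
  then have "exp (- \<gamma> * t / \<tau>) * (?e t * \<bar>y t - c\<bar>)
      \<le> exp (- \<gamma> * t / \<tau>) * (\<bar>y 0 - c\<bar> + ?e t * (a / \<gamma> + b * \<tau> / \<gamma>\<^sup>2))"
    by (intro mult_left_mono) auto
  moreover have cancel: "exp (- \<gamma> * t / \<tau>) * (?e t * z) = z" for z
    by (simp add: exp_minus)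
  ultimately show ?thesis
    unfolding distrib_left[of "exp (- \<gamma> * t / \<tau>)"] cancel by (simp add: add.assoc)
qed

text \<open>
  The velocity \<open>\<eta> = P h\<close> is bounded by compactness, so \<open>h\<close> and therefore \<open>\<eta>\<close> are
  Lipschitz in time. This replaces a bound on \<open>\<eta>'\<close>, which need not exist for a Lipschitz
  field.
\<close>

lemma parabolic_velocity_bounds:
  assumes lip: "lipschitz_field N \<Omega> L P" "0 \<le> L"
    and sol: "parabolic_solution N T P h \<eta>" "\<And>t. t \<in> {0..T} \<Longrightarrow> h t \<in> \<Omega>" and "0 \<le> T"
  obtains B where "0 \<le> B" "\<And>t j. t \<in> {0..T} \<Longrightarrow> j \<in> {1..N} \<Longrightarrow> \<bar>\<eta> t j\<bar> \<le> B"
    "\<And>s t j. s \<in> {0..T} \<Longrightarrow> t \<in> {0..T} \<Longrightarrow> s \<le> t \<Longrightarrow> j \<in> {1..N} \<Longrightarrow> \<bar>\<eta> s j - \<eta> t j\<bar> \<le> L * (real N * B) * (t - s)"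
proof -
  have der: "((\<lambda>s. h s j) has_real_derivative \<eta> t j) (at t within {0..T})"
    and eq: "\<eta> t j = P (h t) j" if "t \<in> {0..T}" "j \<in> {1..N}" for t j
    using sol(1) that unfolding parabolic_solution_def by blast+
  have lip': "\<bar>\<eta> s j - \<eta> t j\<bar> \<le> L * vdist N (h s) (h t)" if "s \<in> {0..T}" "t \<in> {0..T}" "j \<in> {1..N}" for s t j
    using lip(1) sol(2) that eq by (simp add: lipschitz_field_def)
  have "continuous_on {0..T} (\<lambda>t. vdist N (h t) (h 0))"
    by (intro vdist_continuous_on DERIV_continuous_on[OF der] continuous_on_const)
  then obtain t\<^sub>0 where t0: "\<And>t. t \<in> {0..T} \<Longrightarrow> vdist N (h t) (h 0) \<le> vdist N (h t\<^sub>0) (h 0)"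
    using continuous_attains_sup[of "{0..T}" "\<lambda>t. vdist N (h t) (h 0)"] \<open>0 \<le> T\<close> by fastforce
  define B where "B = L * vdist N (h t\<^sub>0) (h 0) + (\<Sum>j\<in>{1..N}. \<bar>\<eta> 0 j\<bar>)"
  have B: "0 \<le> B" using lip(2) by (auto simp: B_def sum_nonneg)
  have bound: "\<bar>\<eta> t j\<bar> \<le> B" if "t \<in> {0..T}" "j \<in> {1..N}" for t j
  proof -
    have "\<bar>\<eta> t j - \<eta> 0 j\<bar> \<le> L * vdist N (h t\<^sub>0) (h 0)"
      using lip'[OF that(1) _ that(2), of 0] mult_left_mono[OF t0[OF that(1)] lip(2)] \<open>0 \<le> T\<close> by auto
    moreover have "\<bar>\<eta> 0 j\<bar> \<le> (\<Sum>j\<in>{1..N}. \<bar>\<eta> 0 j\<bar>)"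
      using that(2) by (intro member_le_sum) auto
    ultimately show ?thesis by (simp add: B_def)
  qed
  show ?thesis
  proof (rule that[OF B bound])
    fix s t j assume st: "s \<in> {0..T}" "t \<in> {0..T}" "s \<le> t" and j: "j \<in> {1..N}"
    have "\<bar>h s i - h t i\<bar> \<le> B * (t - s)" if i: "i \<in> {1..N}" for i
    proof -
      have "\<bar>h t i - h s i\<bar> \<le> B * t - B * s"
      proof (rule growth_bound[where p' = "\<lambda>t. \<eta> t i" and k' = "\<lambda>_. B"])
        fix x assume x: "x \<in> {s..t}"
        show "((\<lambda>t. h t i) has_real_derivative \<eta> x i) (at x within {s..t})"
          by (rule DERIV_subset[OF der[OF _ i]]) (use st x in auto)
        show "((*) B has_real_derivative B) (at x within {s..t})" by (auto intro!: derivative_eq_intros)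
        show "\<bar>\<eta> x i\<bar> \<le> B" using bound i x st by auto
      qed (use st in auto)
      then show ?thesis by (simp add: algebra_simps)
    qed
    then have "vdist N (h s) (h t) \<le> real N * (B * (t - s))" by (rule vdist_le)
    then have "L * vdist N (h s) (h t) \<le> L * (real N * (B * (t - s)))"
      using lip(2) by (intro mult_left_mono)
    then show "\<bar>\<eta> s j - \<eta> t j\<bar> \<le> L * (real N * B) * (t - s)"
      using lip'[OF st(1,2) j] by (simp add: mult_ac)
  qed
qed

lemma parabolic_velocity_continuous:
  assumes "lipschitz_field N \<Omega> L P" "0 \<le> L" "0 \<le> T"
    and "parabolic_solution N T P h \<eta>" "\<And>t. t \<in> {0..T} \<Longrightarrow> h t \<in> \<Omega>" and j: "j \<in> {1..N}"
  shows "continuous_on {0..T} (\<lambda>t. \<eta> t j)"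
proof -
  obtain B where B: "0 \<le> B" "\<And>s t j. s \<in> {0..T} \<Longrightarrow> t \<in> {0..T} \<Longrightarrow> s \<le> t \<Longrightarrow> j \<in> {1..N} \<Longrightarrow>
      \<bar>\<eta> s j - \<eta> t j\<bar> \<le> L * (real N * B) * (t - s)"
    using parabolic_velocity_bounds[OF assms(1,2,4,5,3)] by metis
  have "(L * (real N * B))-lipschitz_on {0..T} (\<lambda>t. \<eta> t j)"
    using B assms(2) j by (intro lipschitz_on_leI) (auto simp: dist_real_def abs_minus_commute)
  then show ?thesis by (rule lipschitz_on_continuous_on)
qed

text \<open>
  The estimate for a single \<open>\<tau>\<close>, with a constant that depends only on the parabolic solution,
  on \<open>L\<close>, on \<open>N\<close> and on \<open>T\<close>. The third bound separates the initial layer of the velocity from the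
  remainder.
\<close>

lemma hyperbolic_parabolic_estimate:
  assumes lip: "lipschitz_field N \<Omega> L P" "0 < L" and N: "1 \<le> N" and T: "0 < T"
    and sol_p: "parabolic_solution N T P hp \<eta>p" "\<And>t. t \<in> {0..T} \<Longrightarrow> hp t \<in> \<Omega>"
  obtains C where "0 < C" and
    "\<And>\<tau> \<gamma> h \<eta> R t. 0 < \<tau> \<Longrightarrow> 1 / 2 \<le> \<gamma> \<Longrightarrow> \<gamma> \<le> 2 \<Longrightarrow> hyperbolic_solution N T P \<tau> \<gamma> h \<eta> \<Longrightarrow>
      (\<And>t. t \<in> {0..T} \<Longrightarrow> h t \<in> \<Omega>) \<Longrightarrow>
      R = \<gamma> * vdist N (h 0) (hp 0) + \<tau> * vdist N (\<eta> 0) (\<eta>p 0) + \<bar>1 - \<gamma>\<bar> + \<tau> \<Longrightarrow> t \<in> {0..T} \<Longrightarrow>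
      vdist N (h t) (hp t) \<le> C * R \<and> \<tau> * vdist N (\<eta> t) (\<eta>p t) \<le> C * R \<and>
      vdist N (\<eta> t) (\<eta>p t) \<le> C * (exp (- \<gamma> * t / \<tau>) * vdist N (\<eta> 0) (\<eta>p 0) + R)"
proof -
  obtain B where B: "0 \<le> B" "\<And>t j. t \<in> {0..T} \<Longrightarrow> j \<in> {1..N} \<Longrightarrow> \<bar>\<eta>p t j\<bar> \<le> B"
    "\<And>s t j. s \<in> {0..T} \<Longrightarrow> t \<in> {0..T} \<Longrightarrow> s \<le> t \<Longrightarrow> j \<in> {1..N} \<Longrightarrow>
       \<bar>\<eta>p s j - \<eta>p t j\<bar> \<le> L * (real N * B) * (t - s)"
    using parabolic_velocity_bounds[OF lip(1) _ sol_p] lip(2) T by (metis less_imp_le)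
  define \<Lambda> where "\<Lambda> = L * (real N * B)"
  \<comment> \<open>This rate makes the Gronwall loop below a contraction with factor \<open>1 /
    2\<close>.\<close>
  define \<omega> where "\<omega> = 4 * real N * L"
  define K\<^sub>0 where "K\<^sub>0 = 1 + 2 * B + B * T"
  define C\<^sub>1 where "C\<^sub>1 = 2 * real N * (2 + 2 * K\<^sub>0) * exp (\<omega> * T)"
  define C\<^sub>2 where "C\<^sub>2 = real N * (K\<^sub>0 + C\<^sub>1 + 2 * C\<^sub>1)"
  define C\<^sub>3 where "C\<^sub>3 = real N * (1 + 2 * \<Lambda> + 2 * (L * C\<^sub>1 + B) + 4 * \<Lambda>)"
  define C where "C = C\<^sub>1 + C\<^sub>2 + C\<^sub>3"
  have \<Lambda>: "0 \<le> \<Lambda>" using lip(2) B(1) by (simp add: \<Lambda>_def)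
  have \<omega>: "0 < \<omega>" using lip(2) N by (simp add: \<omega>_def)
  have K0: "1 \<le> K\<^sub>0" using B(1) T by (simp add: K\<^sub>0_def)
  have C1: "0 < C\<^sub>1" using K0 N by (simp add: C\<^sub>1_def)
  moreover have "0 \<le> L * C\<^sub>1" using C1 lip(2) by simp
  then have "0 < 1 + 2 * \<Lambda> + 2 * (L * C\<^sub>1 + B) + 4 * \<Lambda>" using \<Lambda> B(1)
    by (auto intro!: add_pos_nonneg simp: distrib_left simp del: zero_le_mult_iff)
  ultimately have C: "0 < C\<^sub>1" "0 < C\<^sub>2" "0 < C\<^sub>3"
    using K0 N by (simp_all add: C\<^sub>2_def C\<^sub>3_def)
  show ?thesis
  proof (rule that[of C])
    show "0 < C" using C by (simp add: C_def)
    fix \<tau> \<gamma> h \<eta> R t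
    assume \<tau>: "0 < \<tau>" and \<gamma>: "1 / 2 \<le> \<gamma>" "\<gamma> \<le> 2"
      and sol: "hyperbolic_solution N T P \<tau> \<gamma> h \<eta>" "\<And>t. t \<in> {0..T} \<Longrightarrow> h t \<in> \<Omega>"
      and R: "R = \<gamma> * vdist N (h 0) (hp 0) + \<tau> * vdist N (\<eta> 0) (\<eta>p 0) + \<bar>1 - \<gamma>\<bar> + \<tau>"
      and t: "t \<in> {0..T}"
    define d where "d t = vdist N (h t) (hp t)" for t
    define v\<^sub>0 where "v\<^sub>0 = vdist N (\<eta> 0) (\<eta>p 0)"
    \<comment> \<open>Its derivative contains no factor \<open>1 / \<tau>\<close>, and at time zero \<open>z -
      \<tau> \<eta>p\<close> is bounded by the sum of the weighted errors.\<close>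
    define z where "z j t = \<gamma> * (h t j - hp t j) + \<tau> * \<eta> t j" for j t
    have zero: "0 \<in> {0..T}" using T by simp
    have d_nn: "0 \<le> d t" "0 \<le> v\<^sub>0" for t by (simp_all add: d_def v\<^sub>0_def)
    have R': "R = \<gamma> * d 0 + \<tau> * v\<^sub>0 + \<bar>1 - \<gamma>\<bar> + \<tau>" by (simp add: R d_def v\<^sub>0_def)
    have nnR: "0 \<le> \<gamma> * d 0" "0 \<le> \<tau> * v\<^sub>0" using \<gamma> \<tau> d_nn by auto
    have R_ge: "\<tau> \<le> R" "\<bar>1 - \<gamma>\<bar> \<le> R" "\<gamma> * d 0 \<le> R" "\<tau> * v\<^sub>0 \<le> R" "0 < R"
      using R' nnR \<tau> by auto
    have dh: "((\<lambda>s. h s j) has_real_derivative \<eta> t j) (at t within {0..T})"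
      and d\<eta>: "((\<lambda>s. \<eta> s j) has_real_derivative (P (h t) j - \<gamma> * \<eta> t j) / \<tau>) (at t within {0..T})"
      and dhp: "((\<lambda>s. hp s j) has_real_derivative \<eta>p t j) (at t within {0..T})"
      and \<eta>p: "\<eta>p t j = P (hp t) j"
      if "t \<in> {0..T}" "j \<in> {1..N}" for t j
    proof -
      note S = sol(1)[unfolded hyperbolic_solution_def, rule_format, OF that]
      show "((\<lambda>s. h s j) has_real_derivative \<eta> t j) (at t within {0..T})"
        using S by blast
      obtain \<eta>' where "((\<lambda>s. \<eta> s j) has_real_derivative \<eta>') (at t within {0..T})"
        "\<tau> * \<eta>' = P (h t) j - \<gamma> * \<eta> t j"
        using S by blast
      moreover from this(2) have "\<eta>' = (P (h t) j - \<gamma> * \<eta> t j) / \<tau>"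
        using \<tau> by (simp add: field_simps)
      ultimately show "((\<lambda>s. \<eta> s j) has_real_derivative (P (h t) j - \<gamma> * \<eta> t j) / \<tau>) (at t within {0..T})"
        by simp
      show "((\<lambda>s. hp s j) has_real_derivative \<eta>p t j) (at t within {0..T})" "\<eta>p t j = P (hp t) j"
        using sol_p(1) that unfolding parabolic_solution_def by blast+
    qed
    have P_lip: "\<bar>P (h t) j - \<eta>p t j\<bar> \<le> L * d t" if "t \<in> {0..T}" "j \<in> {1..N}" for t j
      using lip(1) sol(2) sol_p(2) that \<eta>p by (simp add: lipschitz_field_def d_def)
    have "continuous_on {0..T} d"
      unfolding d_def by (intro vdist_continuous_on DERIV_continuous_on[OF dh] DERIV_continuous_on[OF dhp])
    \<comment> \<open>Gronwall through the maximum of the weighted distance: \<open>m\<close> is estimated by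
      half of itself.\<close>
    then have "continuous_on {0..T} (\<lambda>t. exp (- \<omega> * t) * d t)"
      by (intro continuous_intros)
    then obtain t\<^sub>m where tm: "t\<^sub>m \<in> {0..T}"
      "\<And>t. t \<in> {0..T} \<Longrightarrow> exp (- \<omega> * t) * d t \<le> exp (- \<omega> * t\<^sub>m) * d t\<^sub>m"
      using continuous_attains_sup[of "{0..T}" "\<lambda>t. exp (- \<omega> * t) * d t"] T by auto
    define m where "m = exp (- \<omega> * t\<^sub>m) * d t\<^sub>m"
    have m: "0 \<le> m" by (simp add: m_def d_nn)
    have d_le: "d t \<le> m * exp (\<omega> * t)" if "t \<in> {0..T}" for t
    proof -
      have "exp (\<omega> * t) * (exp (- \<omega> * t) * d t) \<le> exp (\<omega> * t) * m"
        unfolding m_def using tm(2)[OF that] by (intro mult_left_mono) auto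
      then show ?thesis by (simp add: exp_minus field_simps)
    qed
    have z_bound: "\<bar>z j s - \<tau> * \<eta>p s j\<bar> \<le> K\<^sub>0 * R + L * m * exp (\<omega> * s) / \<omega>"
      if s: "s \<in> {0..T}" and j: "j \<in> {1..N}" for s j
    proof -
      let ?k = "\<lambda>r. L * m * exp (\<omega> * r) / \<omega> + \<bar>1 - \<gamma>\<bar> * B * r"
      have "\<bar>z j s - z j 0\<bar> \<le> ?k s - ?k 0"
      proof (rule growth_bound[where p' = "\<lambda>r. P (h r) j - \<gamma> * \<eta>p r j"
            and k' = "\<lambda>r. L * m * exp (\<omega> * r) + \<bar>1 - \<gamma>\<bar> * B"])
        fix r assume r: "r \<in> {0..s}"
        then have rT: "r \<in> {0..T}" using s by auto
        have "(z j has_real_derivative P (h r) j - \<gamma> * \<eta>p r j) (at r within {0..T})"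
          unfolding z_def using \<tau> by (auto intro!: derivative_eq_intros dh d\<eta> dhp rT j simp: field_simps)
        then show "(z j has_real_derivative P (h r) j - \<gamma> * \<eta>p r j) (at r within {0..s})"
          by (rule DERIV_subset) (use s in auto)
        show "(?k has_real_derivative L * m * exp (\<omega> * r) + \<bar>1 - \<gamma>\<bar> * B) (at r within {0..s})"
          using \<omega> by (auto intro!: derivative_eq_intros)
        have "P (h r) j - \<gamma> * \<eta>p r j = (P (h r) j - \<eta>p r j) + (1 - \<gamma>) * \<eta>p r j"
          by (simp add: algebra_simps)
        moreover have "\<bar>(1 - \<gamma>) * \<eta>p r j\<bar> \<le> \<bar>1 - \<gamma>\<bar> * B"
          using B(2)[OF rT j] by (simp add: abs_mult mult_left_mono)
        moreover have "L * d r \<le> L * (m * exp (\<omega> * r))"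
          using d_le[OF rT] lip(2) by (intro mult_left_mono) auto
        ultimately show "\<bar>P (h r) j - \<gamma> * \<eta>p r j\<bar> \<le> L * m * exp (\<omega> * r) + \<bar>1 - \<gamma>\<bar> * B"
          using P_lip[OF rT j] by (simp add: mult.assoc)
      qed (use s in auto)
      moreover have "0 \<le> L * m * exp (\<omega> * 0) / \<omega>" using lip(2) m \<omega> by simp
      moreover have "\<bar>1 - \<gamma>\<bar> * B * s \<le> R * (B * T)"
      proof -
        have "\<bar>1 - \<gamma>\<bar> * (B * s) \<le> R * (B * T)"
          using R_ge B(1) s T by (intro mult_mono) auto
        then show ?thesis by (simp add: mult.assoc)
      qed
      moreover have "\<bar>z j 0 - \<tau> * \<eta>p 0 j\<bar> \<le> R"
      proof -
        have "z j 0 - \<tau> * \<eta>p 0 j = \<gamma> * (h 0 j - hp 0 j) + \<tau> * (\<eta> 0 j - \<eta>p 0 j)"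
          by (simp add: z_def algebra_simps)
        moreover have "\<bar>\<gamma> * (h 0 j - hp 0 j)\<bar> \<le> \<gamma> * d 0"
          using component_le_vdist[OF j] \<gamma> by (simp add: abs_mult d_def mult_left_mono)
        moreover have "\<bar>\<tau> * (\<eta> 0 j - \<eta>p 0 j)\<bar> \<le> \<tau> * v\<^sub>0"
          using component_le_vdist[OF j] \<tau> by (simp add: abs_mult v\<^sub>0_def mult_left_mono)
        ultimately show ?thesis using R' \<tau> by linarith
      qed
      moreover have "\<bar>\<tau> * \<eta>p r j\<bar> \<le> R * B" if "r \<in> {0..T}" for r
        using B(1) B(2)[OF that j] R_ge \<tau> by (auto simp: abs_mult intro!: mult_mono)
      from this[OF s] this[OF zero]
      have "\<bar>\<tau> * \<eta>p s j\<bar> \<le> R * B" "\<bar>\<tau> * \<eta>p 0 j\<bar> \<le> R * B" by auto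
      moreover have "K\<^sub>0 * R = R + 2 * (R * B) + R * (B * T)"
        by (simp add: K\<^sub>0_def algebra_simps)
      ultimately show ?thesis
        unfolding abs_le_iff by (intro conjI; linarith)
    qed
    have u_bound: "\<bar>h s j - hp s j\<bar> \<le> (2 + 2 * K\<^sub>0) * R + 2 * L * m * exp (\<omega> * s) / \<omega>"
      if s: "s \<in> {0..T}" and j: "j \<in> {1..N}" for s j
    proof -
      define a where "a = K\<^sub>0 * R + L * m * exp (\<omega> * s) / \<omega>"
      have a: "0 \<le> a" using K0 R_ge lip(2) m \<omega> by (simp add: a_def)
      have "\<bar>(h s j - hp s j) - 0\<bar> \<le>
          exp (- \<gamma> * s / \<tau>) * \<bar>(h 0 j - hp 0 j) - 0\<bar> + a / \<gamma> + 0 * \<tau> / \<gamma>\<^sup>2"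
      proof (rule linear_relaxation[where q = "\<lambda>r. z j r - \<tau> * \<eta>p r j" and y' = "\<lambda>r. \<eta> r j - \<eta>p r j"])
        fix r assume r: "r \<in> {0..s}"
        then have rT: "r \<in> {0..T}" using s by auto
        show "((\<lambda>s. h s j - hp s j) has_real_derivative \<eta> r j - \<eta>p r j) (at r within {0..s})"
          using s by (intro DERIV_subset[OF DERIV_diff[OF dh dhp]] rT j) auto
        show "\<tau> * (\<eta> r j - \<eta>p r j) = z j r - \<tau> * \<eta>p r j - \<gamma> * (h r j - hp r j)"
          by (simp add: z_def algebra_simps)
        have "L * m * exp (\<omega> * r) / \<omega> \<le> L * m * exp (\<omega> * s) / \<omega>"
          using r \<omega> lip(2) m by (intro divide_right_mono mult_left_mono) auto
        then show "\<bar>z j r - \<tau> * \<eta>p r j - \<gamma> * 0\<bar> \<le> a + 0 * (s - r)"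
          using z_bound[OF rT j] by (simp add: a_def)
      qed (use \<tau> \<gamma> a s in auto)
      moreover have "exp (- \<gamma> * s / \<tau>) * \<bar>h 0 j - hp 0 j\<bar> \<le> 1 * d 0"
        using component_le_vdist[OF j, of "h 0" "hp 0"] s \<gamma> \<tau> by (intro mult_mono) (auto simp: d_def)
      moreover have "d 0 \<le> 2 * R"
        using mult_right_mono[OF \<gamma>(1) d_nn(1)[of 0]] R_ge by linarith
      moreover have "a / \<gamma> \<le> a / (1 / 2)"
        using a \<gamma> by (intro divide_left_mono) auto
      ultimately show ?thesis
        by (simp add: a_def algebra_simps)
    qed
    have d_bound: "d s \<le> real N * (2 + 2 * K\<^sub>0) * R + m * exp (\<omega> * s) / 2" if s: "s \<in> {0..T}" for s
    proof -
      have "d s \<le> real N * ((2 + 2 * K\<^sub>0) * R + 2 * L * m * exp (\<omega> * s) / \<omega>)"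
        unfolding d_def using u_bound[OF s] by (rule vdist_le)
      also have "\<dots> = real N * (2 + 2 * K\<^sub>0) * R + m * exp (\<omega> * s) / 2"
        using lip(2) N by (simp add: \<omega>_def field_simps)
      finally show ?thesis .
    qed
    \<comment> \<open>Evaluation at the maximum point; \<open>m\<close> is finite, so \<open>m / 2\<close> can
      be absorbed.\<close>
    have "m \<le> exp (- \<omega> * t\<^sub>m) * (real N * (2 + 2 * K\<^sub>0) * R + m * exp (\<omega> * t\<^sub>m) / 2)"
      unfolding m_def by (intro mult_left_mono d_bound[unfolded m_def] tm) auto
    also have "\<dots> = exp (- \<omega> * t\<^sub>m) * (real N * (2 + 2 * K\<^sub>0) * R) + m / 2"
      by (simp add: exp_minus field_simps)
    also have "\<dots> \<le> 1 * (real N * (2 + 2 * K\<^sub>0) * R) + m / 2"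
      using \<omega> tm(1) K0 R_ge by (intro add_right_mono mult_right_mono) auto
    finally have m_le: "m \<le> 2 * real N * (2 + 2 * K\<^sub>0) * R"
      by simp
    have m_exp: "m * exp (\<omega> * s) \<le> C\<^sub>1 * R" if "s \<in> {0..T}" for s
    proof -
      have "m * exp (\<omega> * s) \<le> (2 * real N * (2 + 2 * K\<^sub>0) * R) * exp (\<omega> * T)"
        using m_le m that \<omega> K0 R_ge by (intro mult_mono) auto
      then show ?thesis by (simp add: C\<^sub>1_def mult_ac)
    qed
    then have d1: "d s \<le> C\<^sub>1 * R" if "s \<in> {0..T}" for s
      using d_le[OF that] that by fastforce
    have CR: "0 \<le> C\<^sub>1 * R" "0 \<le> C\<^sub>2 * R" "0 \<le> C\<^sub>3 * R" using C R_ge by auto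
    have est1: "vdist N (h t) (hp t) \<le> C * R"
      using d1[OF t] CR by (simp add: d_def C_def distrib_right)
    have "\<bar>\<eta> t j - \<eta>p t j\<bar> \<le> (K\<^sub>0 + C\<^sub>1 + 2 * C\<^sub>1) * R / \<tau>" if j: "j \<in> {1..N}" for j
    proof -
      have "\<tau> * (\<eta> t j - \<eta>p t j) = (z j t - \<tau> * \<eta>p t j) - \<gamma> * (h t j - hp t j)"
        by (simp add: z_def algebra_simps)
      moreover have "\<bar>\<gamma> * (h t j - hp t j)\<bar> \<le> 2 * (C\<^sub>1 * R)"
        using component_le_vdist[OF j, of "h t" "hp t"] d1[OF t] \<gamma>
        by (auto simp: abs_mult d_def intro!: mult_mono)
      moreover have "L * m * exp (\<omega> * t) / \<omega> \<le> C\<^sub>1 * R"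
      proof -
        have "L * m * exp (\<omega> * t) / \<omega> = (m * exp (\<omega> * t)) / (4 * real N)"
          using lip(2) by (simp add: \<omega>_def)
        also have "\<dots> \<le> (m * exp (\<omega> * t)) / 1"
          using m N by (intro divide_left_mono) auto
        finally show ?thesis using m_exp[OF t] by simp
      qed
      ultimately have "\<bar>\<tau> * (\<eta> t j - \<eta>p t j)\<bar> \<le> K\<^sub>0 * R + C\<^sub>1 * R + 2 * (C\<^sub>1 * R)"
        using z_bound[OF t j] by linarith
      then have "\<tau> * \<bar>\<eta> t j - \<eta>p t j\<bar> \<le> K\<^sub>0 * R + C\<^sub>1 * R + 2 * (C\<^sub>1 * R)"
        using \<tau> by (simp only: abs_mult abs_of_pos)
      then show ?thesis using \<tau> by (simp add: pos_le_divide_eq algebra_simps)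
    qed
    then have "vdist N (\<eta> t) (\<eta>p t) \<le> real N * ((K\<^sub>0 + C\<^sub>1 + 2 * C\<^sub>1) * R / \<tau>)"
      by (rule vdist_le)
    then have "\<tau> * vdist N (\<eta> t) (\<eta>p t) \<le> C\<^sub>2 * R"
      using \<tau> by (simp add: C\<^sub>2_def field_simps)
    then have est2: "\<tau> * vdist N (\<eta> t) (\<eta>p t) \<le> C * R"
      using CR by (simp add: C_def distrib_right)
    \<comment> \<open>The initial layer; the bound of \<open>e * t\<close> absorbs the drift of
      \<open>\<eta>p\<close> between the times \<open>0\<close> and \<open>t\<close>.\<close>
    define e where "e = exp (- \<gamma> * t / \<tau>)"
    have e: "0 < e" "e \<le> 1" "e * t \<le> 2 * \<tau>"
    proof -
      show "0 < e" "e \<le> 1" using \<gamma> \<tau> t by (auto simp: e_def)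
      have "\<gamma> * t / \<tau> \<le> exp (\<gamma> * t / \<tau>)"
        using exp_ge_add_one_self[of "\<gamma> * t / \<tau>"] by linarith
      then have "e * (\<gamma> * t / \<tau>) \<le> e * exp (\<gamma> * t / \<tau>)"
        using \<open>0 < e\<close> by (intro mult_left_mono) auto
      then have "e * t * \<gamma> \<le> \<tau>"
        using \<tau> by (simp add: e_def exp_minus field_simps)
      moreover have "e * t * (1 / 2) \<le> e * t * \<gamma>"
        using \<gamma> t \<open>0 < e\<close> by (intro mult_left_mono) auto
      ultimately show "e * t \<le> 2 * \<tau>" by linarith
    qed
    have "\<bar>\<eta> t j - \<eta>p t j\<bar> \<le> (1 + 2 * \<Lambda> + 2 * (L * C\<^sub>1 + B) + 4 * \<Lambda>) * (e * v\<^sub>0 + R)"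
      if j: "j \<in> {1..N}" for j
    proof -
      define a where "a = (L * C\<^sub>1 + B) * R"
      have a: "0 \<le> a" using lip(2) C B(1) R_ge by (simp add: a_def)
      have "\<bar>\<eta> t j - \<eta>p t j\<bar> \<le> e * \<bar>\<eta> 0 j - \<eta>p t j\<bar> + a / \<gamma> + \<Lambda> * \<tau> / \<gamma>\<^sup>2"
        unfolding e_def
      proof (rule linear_relaxation[where q = "\<lambda>s. P (h s) j" and y' = "\<lambda>s. (P (h s) j - \<gamma> * \<eta> s j) / \<tau>"])
        fix s assume s: "s \<in> {0..t}"
        then have sT: "s \<in> {0..T}" using t by auto
        show "((\<lambda>s. \<eta> s j) has_real_derivative (P (h s) j - \<gamma> * \<eta> s j) / \<tau>) (at s within {0..t})"
          using t by (intro DERIV_subset[OF d\<eta>] sT j) auto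
        show "\<tau> * ((P (h s) j - \<gamma> * \<eta> s j) / \<tau>) = P (h s) j - \<gamma> * \<eta> s j"
          using \<tau> by simp
        have "P (h s) j - \<gamma> * \<eta>p t j = (P (h s) j - \<eta>p s j) + (\<eta>p s j - \<eta>p t j) + (1 - \<gamma>) * \<eta>p t j"
          by (simp add: algebra_simps)
        moreover have "L * d s \<le> L * (C\<^sub>1 * R)"
          using d1[OF sT] lip(2) by (intro mult_left_mono) auto
        moreover have "\<bar>\<eta>p s j - \<eta>p t j\<bar> \<le> \<Lambda> * (t - s)"
          unfolding \<Lambda>_def using B(3)[OF sT t _ j] s by auto
        moreover have "\<bar>(1 - \<gamma>) * \<eta>p t j\<bar> \<le> R * B"
          using B(1) B(2)[OF t j] R_ge by (auto simp: abs_mult intro!: mult_mono)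
        moreover have "a = L * (C\<^sub>1 * R) + R * B"
          by (simp add: a_def algebra_simps)
        ultimately show "\<bar>P (h s) j - \<gamma> * \<eta>p t j\<bar> \<le> a + \<Lambda> * (t - s)"
          using P_lip[OF sT j] by linarith
      qed (use \<tau> \<gamma> a \<Lambda> t in auto)
      moreover have "e * \<bar>\<eta> 0 j - \<eta>p t j\<bar> \<le> e * v\<^sub>0 + 2 * \<Lambda> * R"
      proof -
        have "\<bar>\<eta>p 0 j - \<eta>p t j\<bar> \<le> \<Lambda> * t"
          unfolding \<Lambda>_def using B(3)[OF zero t _ j] t by auto
        moreover have "\<bar>\<eta> 0 j - \<eta>p 0 j\<bar> \<le> v\<^sub>0"
          using component_le_vdist[OF j] by (simp add: v\<^sub>0_def)
        ultimately have "\<bar>\<eta> 0 j - \<eta>p t j\<bar> \<le> v\<^sub>0 + \<Lambda> * t" by linarith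
        then have "e * \<bar>\<eta> 0 j - \<eta>p t j\<bar> \<le> e * (v\<^sub>0 + \<Lambda> * t)"
          using e(1) by (intro mult_left_mono) auto
        also have "\<dots> = e * v\<^sub>0 + \<Lambda> * (e * t)" by (simp add: algebra_simps)
        also have "\<dots> \<le> e * v\<^sub>0 + \<Lambda> * (2 * R)"
          using e(3) R_ge \<Lambda> by (intro add_left_mono mult_left_mono) auto
        finally show ?thesis by simp
      qed
      moreover have "a / \<gamma> \<le> a / (1 / 2)"
        using a \<gamma> by (intro divide_left_mono) auto
      moreover have "\<Lambda> * \<tau> / \<gamma>\<^sup>2 \<le> 4 * \<Lambda> * R"
      proof -
        have "(1 / 2)\<^sup>2 \<le> \<gamma>\<^sup>2" using \<gamma> by (intro power_mono) auto
        then have "\<Lambda> * \<tau> / \<gamma>\<^sup>2 \<le> \<Lambda> * \<tau> / (1 / 2)\<^sup>2"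
          using \<Lambda> \<tau> \<gamma> by (intro divide_left_mono) auto
        also have "\<dots> = 4 * (\<Lambda> * \<tau>)" by (simp add: power2_eq_square)
        also have "\<dots> \<le> 4 * (\<Lambda> * R)" using \<Lambda> R_ge by (intro mult_left_mono) auto
        finally show ?thesis by simp
      qed
      ultimately have "\<bar>\<eta> t j - \<eta>p t j\<bar> \<le> e * v\<^sub>0 + (2 * \<Lambda> + 2 * (L * C\<^sub>1 + B) + 4 * \<Lambda>) * R"
        by (simp add: a_def algebra_simps)
      also have "\<dots> \<le> (1 + 2 * \<Lambda> + 2 * (L * C\<^sub>1 + B) + 4 * \<Lambda>) * (e * v\<^sub>0 + R)"
      proof -
        define Q where "Q = 2 * \<Lambda> + 2 * (L * C\<^sub>1 + B) + 4 * \<Lambda>"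
        have "0 \<le> Q" using \<Lambda> lip(2) C B(1) by (simp add: Q_def)
        then have "0 \<le> Q * (e * v\<^sub>0)" using e d_nn by simp
        then have "e * v\<^sub>0 + Q * R \<le> (1 + Q) * (e * v\<^sub>0 + R)"
          using R_ge by (simp add: algebra_simps)
        then show ?thesis by (simp add: Q_def add.assoc)
      qed
      finally show ?thesis .
    qed
    then have "vdist N (\<eta> t) (\<eta>p t) \<le> real N * ((1 + 2 * \<Lambda> + 2 * (L * C\<^sub>1 + B) + 4 * \<Lambda>) * (e * v\<^sub>0 + R))"
      by (rule vdist_le)
    also have "\<dots> = C\<^sub>3 * (e * v\<^sub>0 + R)" by (simp add: C\<^sub>3_def)
    also have "\<dots> \<le> C * (e * v\<^sub>0 + R)"
      using C e d_nn R_ge by (intro mult_right_mono) (auto simp: C_def)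
    finally have est3: "vdist N (\<eta> t) (\<eta>p t) \<le> C * (exp (- \<gamma> * t / \<tau>) * vdist N (\<eta> 0) (\<eta>p 0) + R)"
      by (simp add: e_def v\<^sub>0_def)
    show "vdist N (h t) (hp t) \<le> C * R \<and> \<tau> * vdist N (\<eta> t) (\<eta>p t) \<le> C * R \<and>
      vdist N (\<eta> t) (\<eta>p t) \<le> C * (exp (- \<gamma> * t / \<tau>) * vdist N (\<eta> 0) (\<eta>p 0) + R)"
      using est1 est2 est3 by blast
  qed
qed

section \<open>The relaxation limit\<close>

text \<open>
  The layer \<open>e\<^bsup>-\<gamma>t/\<tau>\<^esup>\<close> has total mass at most \<open>\<tau> / \<gamma>\<close>, which compensates an initial
  value \<open>v\<^sub>0\<close> of size \<open>1 / \<tau>\<close>.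
\<close>

lemma integral_initial_layer_le:
  fixes w :: "real \<Rightarrow> real"
  assumes "0 < \<tau>" "0 < \<gamma>" "0 \<le> T" "0 \<le> C" "0 \<le> v\<^sub>0" and w: "continuous_on {0..T} w"
    and le: "\<And>t. t \<in> {0..T} \<Longrightarrow> w t \<le> C * (exp (- \<gamma> * t / \<tau>) * v\<^sub>0 + R)"
  shows "integral {0..T} w \<le> C * (\<tau> * v\<^sub>0 / \<gamma> + R * T)"
proof -
  define G where "G t = C * (- \<tau> / \<gamma> * exp (- \<gamma> * t / \<tau>) * v\<^sub>0 + R * t)" for t
  have "((\<lambda>t. C * (exp (- \<gamma> * t / \<tau>) * v\<^sub>0 + R)) has_integral (G T - G 0)) {0..T}"
  proof (rule fundamental_theorem_of_calculus[OF assms(3)])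
    fix t
    have "(G has_real_derivative C * (exp (- \<gamma> * t / \<tau>) * v\<^sub>0 + R)) (at t within {0..T})"
      unfolding G_def using assms(1,2) by (auto intro!: derivative_eq_intros simp: field_simps)
    then show "(G has_vector_derivative C * (exp (- \<gamma> * t / \<tau>) * v\<^sub>0 + R)) (at t within {0..T})"
      by (rule has_real_derivative_iff_has_vector_derivative[THEN iffD1])
  qed
  then have "integral {0..T} w \<le> G T - G 0"
    using le by (rule has_integral_le[OF integrable_integral[OF integrable_continuous_real[OF w]]])
  also have "\<dots> \<le> C * (\<tau> * v\<^sub>0 / \<gamma> + R * T)"
  proof -
    have "G T - G 0 = C * (\<tau> * v\<^sub>0 / \<gamma> + R * T) - C * (\<tau> / \<gamma> * exp (- \<gamma> * T / \<tau>) * v\<^sub>0)"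
      by (simp add: G_def algebra_simps)
    moreover have "0 \<le> C * (\<tau> / \<gamma> * exp (- \<gamma> * T / \<tau>) * v\<^sub>0)"
      using assms by simp
    ultimately show ?thesis by linarith
  qed
  finally show ?thesis .
qed

lemma cSUP_between:
  fixes w :: "'a \<Rightarrow> real"
  assumes "S \<noteq> {}" "\<And>t. t \<in> S \<Longrightarrow> 0 \<le> w t \<and> w t \<le> c"
  shows "0 \<le> (SUP t\<in>S. w t) \<and> (SUP t\<in>S. w t) \<le> c"
proof
  obtain t where t: "t \<in> S" using assms(1) by blast
  have "w t \<le> (SUP t\<in>S. w t)"
    using assms(2) t by (intro cSUP_upper bdd_aboveI2[of _ _ c]) auto
  then show "0 \<le> (SUP t\<in>S. w t)" using assms(2)[OF t] by linarith
  show "(SUP t\<in>S. w t) \<le> c" using assms by (intro cSUP_least) auto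
qed

text \<open>
  For \<open>\<tau>\<close> small, \<open>\<gamma>\<close> lies between \<open>1 / 2\<close> and \<open>2\<close>, so that the single estimate applies with
  one constant. The initial layer enters through \<open>\<tau> \<bar>\<eta> - \<eta>\<^sub>p\<bar> \<le> E\<close> at time zero: integrated over
  time it contributes a multiple of \<open>E\<close>, and after a time \<open>t1\<close> it is at most a multiple of
  \<open>\<tau> / t1\<close>.
\<close>

lemma relaxation_limit:
  fixes h \<eta> :: "real \<Rightarrow> real \<Rightarrow> nat \<Rightarrow> real" and \<gamma> :: "real \<Rightarrow> real" and \<tau>0 :: ereal
  assumes lip: "lipschitz_field N \<Omega> L P" "0 < L" and N: "1 \<le> N" and T: "0 < T" and \<tau>0: "0 < \<tau>0"
    and \<gamma>: "(\<gamma> \<longlongrightarrow> 1) (at_right 0)"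
    and sol: "\<forall>\<^sub>F \<tau> in at_right 0. hyperbolic_solution N T P \<tau> (\<gamma> \<tau>) (h \<tau>) (\<eta> \<tau>) \<and>
      (\<forall>t\<in>{0..T}. h \<tau> t \<in> \<Omega>)"
    and sol_p: "parabolic_solution N T P hp \<eta>p" "\<forall>t\<in>{0..T}. hp t \<in> \<Omega>"
    and E: "\<forall>\<tau> t. E \<tau> t = \<gamma> \<tau> * vdist N (h \<tau> t) (hp t) + \<tau> * vdist N (\<eta> \<tau> t) (\<eta>p t)"
  shows "(\<exists>\<tau>1>0. ereal \<tau>1 \<le> \<tau>0 \<and>
         (\<exists>C>0. \<forall>\<tau>\<in>{0<..<\<tau>1}.
            (\<forall>t\<in>{0..T}. E \<tau> t \<le> C * (E \<tau> 0 + \<bar>1 - \<gamma> \<tau>\<bar> + \<tau>)) \<and>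
            integral {0..T} (\<lambda>t. vdist N (\<eta> \<tau> t) (\<eta>p t))
              \<le> C / \<gamma> \<tau> * (E \<tau> 0 + \<bar>1 - \<gamma> \<tau>\<bar> + \<tau>)) \<and>
         (\<forall>t1\<in>{0<..<T}. \<exists>C>0. \<forall>\<tau>\<in>{0<..<\<tau>1}. \<forall>t\<in>{t1..T}.
            vdist N (\<eta> \<tau> t) (\<eta>p t) \<le> C / \<gamma> \<tau> * (E \<tau> 0 + \<bar>1 - \<gamma> \<tau>\<bar> + \<tau>))) \<and>
      (((\<lambda>\<tau>. E \<tau> 0) \<longlongrightarrow> 0) (at_right 0) \<longrightarrow>
         ((\<lambda>\<tau>. SUP t\<in>{0..T}. vdist N (h \<tau> t) (hp t)) \<longlongrightarrow> 0) (at_right 0) \<and>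
         ((\<lambda>\<tau>. integral {0..T} (\<lambda>t. vdist N (\<eta> \<tau> t) (\<eta>p t))) \<longlongrightarrow> 0) (at_right 0) \<and>
         (\<forall>t1\<in>{0<..<T}.
            ((\<lambda>\<tau>. SUP t\<in>{t1..T}. vdist N (\<eta> \<tau> t) (\<eta>p t)) \<longlongrightarrow> 0) (at_right 0)))"
proof -
  define R where "R \<tau> = E \<tau> 0 + \<bar>1 - \<gamma> \<tau>\<bar> + \<tau>" for \<tau>
  obtain C where C: "0 < C" and est: "\<And>\<tau> \<gamma> h \<eta> R t. 0 < \<tau> \<Longrightarrow> 1 / 2 \<le> \<gamma> \<Longrightarrow> \<gamma> \<le> 2 \<Longrightarrow>
      hyperbolic_solution N T P \<tau> \<gamma> h \<eta> \<Longrightarrow> (\<And>t. t \<in> {0..T} \<Longrightarrow> h t \<in> \<Omega>) \<Longrightarrow>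
      R = \<gamma> * vdist N (h 0) (hp 0) + \<tau> * vdist N (\<eta> 0) (\<eta>p 0) + \<bar>1 - \<gamma>\<bar> + \<tau> \<Longrightarrow> t \<in> {0..T} \<Longrightarrow>
      vdist N (h t) (hp t) \<le> C * R \<and> \<tau> * vdist N (\<eta> t) (\<eta>p t) \<le> C * R \<and>
      vdist N (\<eta> t) (\<eta>p t) \<le> C * (exp (- \<gamma> * t / \<tau>) * vdist N (\<eta> 0) (\<eta>p 0) + R)"
    using hyperbolic_parabolic_estimate[OF lip N T sol_p(1)] sol_p(2) by blast
  have "\<forall>\<^sub>F \<tau> in at_right 0. 1 / 2 < \<gamma> \<tau>" "\<forall>\<^sub>F \<tau> in at_right 0. \<gamma> \<tau> < 2"
    by (rule order_tendstoD[OF \<gamma>]; simp)+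
  then have "\<forall>\<^sub>F \<tau> in at_right 0. 1 / 2 < \<gamma> \<tau> \<and> \<gamma> \<tau> < 2 \<and>
      hyperbolic_solution N T P \<tau> (\<gamma> \<tau>) (h \<tau>) (\<eta> \<tau>) \<and> (\<forall>t\<in>{0..T}. h \<tau> t \<in> \<Omega>)"
    using sol by eventually_elim auto
  then obtain \<tau>\<^sub>2 where \<tau>2: "0 < \<tau>\<^sub>2" "\<And>\<tau>. 0 < \<tau> \<Longrightarrow> \<tau> < \<tau>\<^sub>2 \<Longrightarrow> 1 / 2 < \<gamma> \<tau> \<and> \<gamma> \<tau> < 2 \<and>
      hyperbolic_solution N T P \<tau> (\<gamma> \<tau>) (h \<tau>) (\<eta> \<tau>) \<and> (\<forall>t\<in>{0..T}. h \<tau> t \<in> \<Omega>)"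
    by (auto simp: eventually_at_right_field)
  obtain \<tau>\<^sub>1 where \<tau>1: "0 < \<tau>\<^sub>1" "\<tau>\<^sub>1 \<le> \<tau>\<^sub>2" "ereal \<tau>\<^sub>1 \<le> \<tau>0"
  proof (cases \<tau>0)
    case (real r)
    then show ?thesis using that[of "min \<tau>\<^sub>2 r"] \<tau>0 \<tau>2(1) by auto
  qed (use that[of \<tau>\<^sub>2] \<tau>0 \<tau>2(1) in auto)
  have \<gamma>_bounds: "1 / 2 < \<gamma> \<tau>" "\<gamma> \<tau> < 2" if "\<tau> \<in> {0<..<\<tau>\<^sub>1}" for \<tau>
    using \<tau>2(2)[of \<tau>] \<tau>1 that by auto
  have R_nonneg: "0 \<le> R \<tau>" and layer: "\<tau> * vdist N (\<eta> \<tau> 0) (\<eta>p 0) \<le> R \<tau>" if "\<tau> \<in> {0<..<\<tau>\<^sub>1}" for \<tau>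
  proof -
    have "0 \<le> \<gamma> \<tau> * vdist N (h \<tau> 0) (hp 0)" "0 \<le> \<tau> * vdist N (\<eta> \<tau> 0) (\<eta>p 0)"
      using \<gamma>_bounds[OF that] that by auto
    then show "0 \<le> R \<tau>" "\<tau> * vdist N (\<eta> \<tau> 0) (\<eta>p 0) \<le> R \<tau>"
      using that by (auto simp: R_def E)
  qed
  have pos: "vdist N (h \<tau> t) (hp t) \<le> C * R \<tau>" and vel: "\<tau> * vdist N (\<eta> \<tau> t) (\<eta>p t) \<le> C * R \<tau>"
    and vel': "vdist N (\<eta> \<tau> t) (\<eta>p t) \<le> C * (exp (- \<gamma> \<tau> * t / \<tau>) * vdist N (\<eta> \<tau> 0) (\<eta>p 0) + R \<tau>)"
    if "\<tau> \<in> {0<..<\<tau>\<^sub>1}" "t \<in> {0..T}" for \<tau> t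
  proof -
    have "0 < \<tau>" "1 / 2 \<le> \<gamma> \<tau>" "\<gamma> \<tau> \<le> 2" "hyperbolic_solution N T P \<tau> (\<gamma> \<tau>) (h \<tau>) (\<eta> \<tau>)"
      and \<Omega>: "\<forall>t\<in>{0..T}. h \<tau> t \<in> \<Omega>"
      using \<tau>2(2)[of \<tau>] \<tau>1(2) that(1) by auto
    from est[OF this(1-4) bspec[OF \<Omega>] _ that(2), of "R \<tau>"]
    show "vdist N (h \<tau> t) (hp t) \<le> C * R \<tau>" "\<tau> * vdist N (\<eta> \<tau> t) (\<eta>p t) \<le> C * R \<tau>"
      "vdist N (\<eta> \<tau> t) (\<eta>p t) \<le> C * (exp (- \<gamma> \<tau> * t / \<tau>) * vdist N (\<eta> \<tau> 0) (\<eta>p 0) + R \<tau>)"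
      by (simp_all add: R_def E)
  qed
  have energy: "E \<tau> t \<le> 3 * C * R \<tau>" if \<tau>: "\<tau> \<in> {0<..<\<tau>\<^sub>1}" and t: "t \<in> {0..T}" for \<tau> t
  proof -
    have "\<gamma> \<tau> * vdist N (h \<tau> t) (hp t) \<le> 2 * (C * R \<tau>)"
      using \<gamma>_bounds[OF \<tau>] pos[OF \<tau> t] by (intro mult_mono) auto
    then show ?thesis using vel[OF \<tau> t] by (simp add: E)
  qed
  have int: "0 \<le> integral {0..T} (\<lambda>t. vdist N (\<eta> \<tau> t) (\<eta>p t)) \<and>
      integral {0..T} (\<lambda>t. vdist N (\<eta> \<tau> t) (\<eta>p t)) \<le> C * (2 + T) * R \<tau>"
    if \<tau>: "\<tau> \<in> {0<..<\<tau>\<^sub>1}" for \<tau>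
  proof -
    let ?v\<^sub>0 = "vdist N (\<eta> \<tau> 0) (\<eta>p 0)"
    have "hyperbolic_solution N T P \<tau> (\<gamma> \<tau>) (h \<tau>) (\<eta> \<tau>)"
      using \<tau>2(2)[of \<tau>] \<tau>1 \<tau> by auto
    then have "continuous_on {0..T} (\<lambda>t. \<eta> \<tau> t j)" if "j \<in> {1..N}" for j
      unfolding hyperbolic_solution_def continuous_on_eq_continuous_within
      using that DERIV_continuous by blast
    moreover have "continuous_on {0..T} (\<lambda>t. \<eta>p t j)" if "j \<in> {1..N}" for j
      using lip T sol_p that by (intro parabolic_velocity_continuous[where P = P and \<Omega> = \<Omega>]) auto
    ultimately have cont: "continuous_on {0..T} (\<lambda>t. vdist N (\<eta> \<tau> t) (\<eta>p t))"
      by (intro vdist_continuous_on)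
    have "integral {0..T} (\<lambda>t. vdist N (\<eta> \<tau> t) (\<eta>p t)) \<le> C * (\<tau> * ?v\<^sub>0 / \<gamma> \<tau> + R \<tau> * T)"
      using \<tau> \<gamma>_bounds[OF \<tau>] T C cont vel'[OF \<tau>] by (intro integral_initial_layer_le) auto
    also have "\<dots> \<le> C * (2 * R \<tau> + R \<tau> * T)"
    proof -
      have "\<tau> * ?v\<^sub>0 / \<gamma> \<tau> \<le> R \<tau> / (1 / 2)"
        using layer[OF \<tau>] R_nonneg[OF \<tau>] \<gamma>_bounds[OF \<tau>] by (intro frac_le) auto
      then show ?thesis using C by (intro mult_left_mono add_right_mono) auto
    qed
    finally have "integral {0..T} (\<lambda>t. vdist N (\<eta> \<tau> t) (\<eta>p t)) \<le> C * (2 + T) * R \<tau>"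
      by (simp add: algebra_simps)
    then show ?thesis
      using cont by (auto intro!: integral_nonneg integrable_continuous_real)
  qed
  have late: "vdist N (\<eta> \<tau> t) (\<eta>p t) \<le> C * (2 / t1 + 1) * R \<tau>"
    if \<tau>: "\<tau> \<in> {0<..<\<tau>\<^sub>1}" and t1: "t1 \<in> {0<..<T}" and t: "t \<in> {t1..T}" for \<tau> t1 t
  proof -
    let ?v\<^sub>0 = "vdist N (\<eta> \<tau> 0) (\<eta>p 0)"
    let ?x = "\<gamma> \<tau> * t / \<tau>"
    have x: "t1 / (2 * \<tau>) \<le> ?x" "0 < t1 / (2 * \<tau>)"
    proof -
      have "1 / 2 * t1 \<le> \<gamma> \<tau> * t"
        using \<gamma>_bounds[OF \<tau>] t t1 by (intro mult_mono) auto
      then show "t1 / (2 * \<tau>) \<le> ?x" using \<tau> by (simp add: field_simps)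
    qed (use \<tau> t1 in auto)
    have "exp (- ?x) * ?v\<^sub>0 \<le> (2 * \<tau> / t1) * ?v\<^sub>0"
    proof (rule mult_right_mono)
      have "t1 / (2 * \<tau>) \<le> exp ?x"
        using exp_ge_add_one_self[of ?x] x by linarith
      then have "inverse (exp ?x) \<le> inverse (t1 / (2 * \<tau>))"
        using x(2) by (rule le_imp_inverse_le)
      then show "exp (- ?x) \<le> 2 * \<tau> / t1" by (simp add: exp_minus)
    qed simp
    also have "\<dots> = 2 / t1 * (\<tau> * ?v\<^sub>0)" by simp
    also have "\<dots> \<le> 2 / t1 * R \<tau>"
      using layer[OF \<tau>] t1 by (intro mult_left_mono) auto
    finally have "exp (- ?x) * ?v\<^sub>0 + R \<tau> \<le> (2 / t1 + 1) * R \<tau>"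
      by (simp add: distrib_right)
    then have "C * (exp (- ?x) * ?v\<^sub>0 + R \<tau>) \<le> C * ((2 / t1 + 1) * R \<tau>)"
      using C by (intro mult_left_mono) auto
    moreover have "t \<in> {0..T}" using t t1 by auto
    ultimately show ?thesis using vel'[OF \<tau>, of t] by (simp add: mult.assoc)
  qed
  \<comment> \<open>The bounds are stated with a factor \<open>1 / \<gamma>\<close>; as \<open>\<gamma> <
    2\<close>, it costs a factor \<open>2\<close>.\<close>
  have gain: "A * R \<tau> \<le> 2 * A / \<gamma> \<tau> * R \<tau>" if \<tau>: "\<tau> \<in> {0<..<\<tau>\<^sub>1}" and "0 \<le> A" for \<tau> A
  proof -
    have "A * 1 \<le> A * (2 / \<gamma> \<tau>)"
      using that(2) \<gamma>_bounds[OF \<tau>] by (intro mult_left_mono) auto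
    then show ?thesis using R_nonneg[OF \<tau>] by (intro mult_right_mono) (auto simp: mult.commute)
  qed
  define C' where "C' = 3 * C + 2 * (C * (2 + T))"
  have C': "0 < C'" "3 * C \<le> C'" "2 * (C * (2 + T)) \<le> C'" using C T by (auto simp: C'_def add_pos_pos)
  have bounds1: "\<forall>\<tau>\<in>{0<..<\<tau>\<^sub>1}. (\<forall>t\<in>{0..T}. E \<tau> t \<le> C' * R \<tau>) \<and>
      integral {0..T} (\<lambda>t. vdist N (\<eta> \<tau> t) (\<eta>p t)) \<le> C' / \<gamma> \<tau> * R \<tau>"
  proof (intro ballI conjI)
    fix \<tau> t assume \<tau>: "\<tau> \<in> {0<..<\<tau>\<^sub>1}" and t: "t \<in> {0..T}"
    show "E \<tau> t \<le> C' * R \<tau>"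
      using energy[OF \<tau> t] mult_right_mono[OF C'(2) R_nonneg[OF \<tau>]] by linarith
  next
    fix \<tau> assume \<tau>: "\<tau> \<in> {0<..<\<tau>\<^sub>1}"
    have "integral {0..T} (\<lambda>t. vdist N (\<eta> \<tau> t) (\<eta>p t)) \<le> C * (2 + T) * R \<tau>"
      using int[OF \<tau>] by blast
    also have "\<dots> \<le> 2 * (C * (2 + T)) / \<gamma> \<tau> * R \<tau>"
      using C T by (intro gain[OF \<tau>]) auto
    also have "\<dots> \<le> C' / \<gamma> \<tau> * R \<tau>"
      using C'(3) \<gamma>_bounds[OF \<tau>] R_nonneg[OF \<tau>] by (intro mult_right_mono divide_right_mono) auto
    finally show "integral {0..T} (\<lambda>t. vdist N (\<eta> \<tau> t) (\<eta>p t)) \<le> C' / \<gamma> \<tau> * R \<tau>" .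
  qed
  have bounds2: "\<exists>C>0. \<forall>\<tau>\<in>{0<..<\<tau>\<^sub>1}. \<forall>t\<in>{t1..T}. vdist N (\<eta> \<tau> t) (\<eta>p t) \<le> C / \<gamma> \<tau> * R \<tau>"
    if t1: "t1 \<in> {0<..<T}" for t1
  proof (intro exI[of _ "2 * (C * (2 / t1 + 1))"] conjI ballI)
    have nn: "0 < C * (2 / t1 + 1)" using C t1 by (auto intro!: mult_pos_pos add_pos_pos)
    then show "0 < 2 * (C * (2 / t1 + 1))" by simp
    fix \<tau> t assume \<tau>: "\<tau> \<in> {0<..<\<tau>\<^sub>1}" and t: "t \<in> {t1..T}"
    show "vdist N (\<eta> \<tau> t) (\<eta>p t) \<le> 2 * (C * (2 / t1 + 1)) / \<gamma> \<tau> * R \<tau>"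
      using late[OF \<tau> t1 t] gain[OF \<tau> less_imp_le[OF nn]] by linarith
  qed
  have limits: "((\<lambda>\<tau>. SUP t\<in>{0..T}. vdist N (h \<tau> t) (hp t)) \<longlongrightarrow> 0) (at_right 0) \<and>
         ((\<lambda>\<tau>. integral {0..T} (\<lambda>t. vdist N (\<eta> \<tau> t) (\<eta>p t))) \<longlongrightarrow> 0) (at_right 0) \<and>
         (\<forall>t1\<in>{0<..<T}.
            ((\<lambda>\<tau>. SUP t\<in>{t1..T}. vdist N (\<eta> \<tau> t) (\<eta>p t)) \<longlongrightarrow> 0) (at_right 0))"
    if E0: "((\<lambda>\<tau>. E \<tau> 0) \<longlongrightarrow> 0) (at_right 0)"
  proof -
    have "(R \<longlongrightarrow> 0 + \<bar>1 - 1\<bar> + 0) (at_right 0)"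
      unfolding R_def by (intro tendsto_intros E0 \<gamma>)
    then have R0: "((\<lambda>\<tau>. A * R \<tau>) \<longlongrightarrow> 0) (at_right 0)" for A
      using tendsto_mult_right_zero[of R "at_right 0" A] by simp
    have squeeze: "(p \<longlongrightarrow> 0) (at_right 0)"
      if p: "\<And>\<tau>. \<tau> \<in> {0<..<\<tau>\<^sub>1} \<Longrightarrow> 0 \<le> p \<tau> \<and> p \<tau> \<le> A * R \<tau>" for p :: "real \<Rightarrow> real" and A
    proof (rule tendsto_sandwich[OF _ _ tendsto_const R0])
      show "\<forall>\<^sub>F \<tau> in at_right 0. 0 \<le> p \<tau>" "\<forall>\<^sub>F \<tau> in at_right 0. p \<tau> \<le> A * R \<tau>"
        using eventually_at_right_real[OF \<tau>1(1)] by (eventually_elim; use p in blast)+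
    qed
    have "((\<lambda>\<tau>. SUP t\<in>{0..T}. vdist N (h \<tau> t) (hp t)) \<longlongrightarrow> 0) (at_right 0)"
      using pos T by (intro squeeze[of _ C] cSUP_between) auto
    moreover have "((\<lambda>\<tau>. integral {0..T} (\<lambda>t. vdist N (\<eta> \<tau> t) (\<eta>p t))) \<longlongrightarrow> 0) (at_right 0)"
      using int by (rule squeeze)
    moreover have "((\<lambda>\<tau>. SUP t\<in>{t1..T}. vdist N (\<eta> \<tau> t) (\<eta>p t)) \<longlongrightarrow> 0) (at_right 0)"
      if "t1 \<in> {0<..<T}" for t1
      using late that by (intro squeeze[of _ "C * (2 / t1 + 1)"] cSUP_between) auto
    ultimately show ?thesis by blast
  qed
  show ?thesis
    unfolding R_def[symmetric] using \<tau>1 C'(1) bounds1 bounds2 limits by blast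
qed

theorem theorem4p5:
  fixes F :: "real \<Rightarrow> real" and L0 :: real
    and \<phi> :: "real \<Rightarrow> real \<Rightarrow> real \<Rightarrow> real \<Rightarrow> real"
  assumes "double_well F"
    and "profile_family F L0 \<phi>"
  shows "\<exists>\<rho>0>0. \<rho>0 \<le> 1 / L0 \<and>
    (\<forall>(N::nat) (\<epsilon>::real) (\<rho>::real) (T::real) (\<tau>0::ereal) (g :: real \<Rightarrow> real \<Rightarrow> real)
      (h :: real \<Rightarrow> real \<Rightarrow> nat \<Rightarrow> real) (\<eta> :: real \<Rightarrow> real \<Rightarrow> nat \<Rightarrow> real)
      (hp :: real \<Rightarrow> nat \<Rightarrow> real) (\<eta>p :: real \<Rightarrow> nat \<Rightarrow> real)
      (E :: real \<Rightarrow> real \<Rightarrow> real).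
      N \<ge> 1 \<longrightarrow> \<epsilon> > 0 \<longrightarrow> 0 < \<rho> \<longrightarrow> \<rho> < \<rho>0 \<longrightarrow> T > 0 \<longrightarrow> \<tau>0 > 0 \<longrightarrow> damping \<tau>0 g \<longrightarrow>
      (gam F g \<longlongrightarrow> 1) (at_right 0) \<longrightarrow>
      (\<forall>\<^sub>F \<tau> in at_right 0.
         hyperbolic_solution N T (P_star F \<phi> \<epsilon> N) \<tau> (gam F g \<tau>) (h \<tau>) (\<eta> \<tau>) \<and>
         (\<forall>t\<in>{0..T}. h \<tau> t \<in> Omega N \<epsilon> \<rho>)) \<longrightarrow>
      parabolic_solution N T (P_star F \<phi> \<epsilon> N) hp \<eta>p \<longrightarrow>
      (\<forall>t\<in>{0..T}. hp t \<in> Omega N \<epsilon> \<rho>) \<longrightarrow>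
      (\<forall>\<tau> t. E \<tau> t = gam F g \<tau> * vdist N (h \<tau> t) (hp t) + \<tau> * vdist N (\<eta> \<tau> t) (\<eta>p t)) \<longrightarrow>
      (\<exists>\<tau>1>0. ereal \<tau>1 \<le> \<tau>0 \<and>
         (\<exists>C>0. \<forall>\<tau>\<in>{0<..<\<tau>1}.
            (\<forall>t\<in>{0..T}. E \<tau> t \<le> C * (E \<tau> 0 + \<bar>1 - gam F g \<tau>\<bar> + \<tau>)) \<and>
            integral {0..T} (\<lambda>t. vdist N (\<eta> \<tau> t) (\<eta>p t))
              \<le> C / gam F g \<tau> * (E \<tau> 0 + \<bar>1 - gam F g \<tau>\<bar> + \<tau>)) \<and>
         (\<forall>t1\<in>{0<..<T}. \<exists>C>0. \<forall>\<tau>\<in>{0<..<\<tau>1}. \<forall>t\<in>{t1..T}.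
            vdist N (\<eta> \<tau> t) (\<eta>p t)
              \<le> C / gam F g \<tau> * (E \<tau> 0 + \<bar>1 - gam F g \<tau>\<bar> + \<tau>))) \<and>
      (((\<lambda>\<tau>. E \<tau> 0) \<longlongrightarrow> 0) (at_right 0) \<longrightarrow>
         ((\<lambda>\<tau>. SUP t\<in>{0..T}. vdist N (h \<tau> t) (hp t)) \<longlongrightarrow> 0) (at_right 0) \<and>
         ((\<lambda>\<tau>. integral {0..T} (\<lambda>t. vdist N (\<eta> \<tau> t) (\<eta>p t))) \<longlongrightarrow> 0) (at_right 0) \<and>
         (\<forall>t1\<in>{0<..<T}.
            ((\<lambda>\<tau>. SUP t\<in>{t1..T}. vdist N (\<eta> \<tau> t) (\<eta>p t)) \<longlongrightarrow> 0) (at_right 0))))"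
proof -
  obtain \<rho>\<^sub>0 where \<rho>0: "0 < \<rho>\<^sub>0" "\<rho>\<^sub>0 \<le> 1 / L0"
    and lip: "\<And>(N::nat) \<epsilon> \<rho>. 1 \<le> N \<Longrightarrow> 0 < \<epsilon> \<Longrightarrow> 0 < \<rho> \<Longrightarrow> \<rho> < \<rho>\<^sub>0 \<Longrightarrow>
      \<exists>L>0. lipschitz_field N (Omega N \<epsilon> \<rho>) L (P_star F \<phi> \<epsilon> N)"
    using P_star_lipschitz[OF assms] by blast
  show ?thesis
  proof (rule exI[of _ \<rho>\<^sub>0], rule conjI[OF \<rho>0(1)], rule conjI[OF \<rho>0(2)], intro allI impI, goal_cases)
    case (1 N \<epsilon> \<rho> T \<tau>0 g h \<eta> hp \<eta>p E)
    obtain L where L: "0 < L" "lipschitz_field N (Omega N \<epsilon> \<rho>) L (P_star F \<phi> \<epsilon> N)"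
      using lip[OF 1(1-4)] by blast
    show ?case
      by (rule relaxation_limit[OF L(2,1) 1(1,5,6,8-12)])
  qed
qed

end
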